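(* Let $R$ be a commutative domain of characteristic zero containing $\mathbb{Q}$, $d$ a nonzero derivation of $R$, and $\Gamma$ a group acting (on the right) by automorphisms on $R$. Then the action of $\Gamma$ on $R$ extends to an action of $\Gamma$ by automorphisms on $B=R(\!(x;d)\!)$ if and only if it is $d$-compatible. In this case the extended actions are given by $$x^{-1}\cdot\gamma=p_{\gamma}x^{-1}+p_{\gamma}r_{\gamma}\qquad\text{for any }\gamma\in\Gamma,$$ where $p\in Z^1(\Gamma,U(R))$ is the $1$-cocycle associated to the $d$-compatibility and $r$ is an arbitrary map $\Gamma\to R$ satisfying $$r_{\gamma\gamma'}=r_{\gamma'}+p_{\gamma'}^{-1}(r_{\gamma}\cdot\gamma')\qquad\text{for all }\gamma,\gamma'\in\Gamma.$$ In particular, the action of $\Gamma$ on $R$ extends to an action by automorphisms on $B$ if and only if it extends to an action by automorphisms on the subring $A=R[x^{-1};-d]$.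
   Context: $U(R)$ is the group of invertible elements of $R$. $B=R(\!(x;d)\!)$ is the ring of formal pseudodifferential operators: its elements are the Laurent series $\sum_{i\ge m}f_ix^i$ ($m\in\mathbb{Z}$, $f_i\in R$) with multiplication determined by $xf=\sum_{n\ge0}d^n(f)x^{n+1}$, equivalently $x^{-1}f=fx^{-1}-d(f)$, for $f\in R$. $A=R[x^{-1};-d]$ is the subring of $B$ of polynomials in $x^{-1}$ with coefficients in $R$. Actions are right actions: $(f\cdot\gamma)\cdot\gamma'=f\cdot\gamma\gamma'$. A $1$-cocycle is a map $s:\Gamma\to U(R)$, $\gamma\mapsto s_\gamma$, with $s_{\gamma\gamma'}=(s_\gamma\cdot\gamma')s_{\gamma'}$ for all $\gamma,\gamma'$; $Z^1(\Gamma,U(R))$ is the multiplicative group of these. The action of $\Gamma$ on $R$ is $d$-compatible if for every $\gamma\in\Gamma$ there is $p_\gamma\in U(R)$ with $d(f)\cdot\gamma=p_\gamma\,d(f\cdot\gamma)$ for all $f\in R$; this defines uniquely a map $p:\gamma\mapsto p_\gamma$, which belongs to $Z^1(\Gamma,U(R))$ and is called the $1$-cocycle associated to the $d$-compatibility. An action on $B$ (or $A$) extends the action on $R$ if its restriction to $R$ is the given action. *)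

theory Defs
  imports
    "HOL-Algebra.Algebraic_Closure_Type"
    "HOL-Computational_Algebra.Formal_Laurent_Series"
begin

section \<open>Derivations and pseudodifferential operators\<close>

definition derivation :: "('a::comm_ring_1 \<Rightarrow> 'a) \<Rightarrow> bool" where
  "derivation d \<longleftrightarrow>
     (\<forall>f g. d (f + g) = d f + d g) \<and> (\<forall>f g. d (f * g) = d f * g + f * d g)"

text \<open>
  The operator sum of \<open>f\<^sub>i x\<^sup>i\<close> (coefficients on the left) is encoded as the library's Laurent
  series with coefficients \<open>f\<^sub>i\<close>. Only the additive structure of that type is used; the product
  below is the one forced by \<open>x f = \<Sum>n\<ge>0. d\<^sup>n(f) x\<^sup>n\<^sup>+\<^sup>1\<close>, that is, by
  \<open>x\<^sup>i f = \<Sum>n\<ge>0. c(i, n) d\<^sup>n(f) x\<^sup>i\<^sup>+\<^sup>n\<close> for every integer \<open>i\<close>, where \<open>c(i, n)\<close> is the generalised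
  binomial coefficient \<open>(i + n - 1) gchoose n\<close>; for \<open>i = -k \<le> 0\<close> it equals \<open>(-1)\<^sup>n (k choose n)\<close>.
  The coefficient function is supported in degrees
  \<open>\<ge> fls_subdegree F + fls_subdegree G\<close> and each sum is finite (see \<open>finite_pdo_index\<close> and
  \<open>pdo_mult_nth\<close>), so that no junk value of \<open>Abs_fls\<close> or \<open>sum\<close> occurs.
\<close>

definition pdo_coeff :: "int \<Rightarrow> nat \<Rightarrow> int" where
  "pdo_coeff i n =
     (if i > 0 then int ((nat i + n - 1) choose n) else (-1) ^ n * int (nat (- i) choose n))"

definition pdo_mult :: "('a::comm_ring_1 \<Rightarrow> 'a) \<Rightarrow> 'a fls \<Rightarrow> 'a fls \<Rightarrow> 'a fls" where
  "pdo_mult d F G = Abs_fls (\<lambda>k.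
     \<Sum>(i, n) | fls_nth F i \<noteq> 0 \<and> fls_nth G (k - i - int n) \<noteq> 0.
       fls_nth F i * of_int (pdo_coeff i n) * (d ^^ n) (fls_nth G (k - i - int n)))"

definition pdo_ring :: "('a::comm_ring_1 \<Rightarrow> 'a) \<Rightarrow> 'a fls ring" where
  "pdo_ring d =
     \<lparr>carrier = UNIV, monoid.mult = pdo_mult d, one = 1, ring.zero = 0, add = (+)\<rparr>"

text \<open>The subring \<open>R[x\<^sup>-\<^sup>1; -d]\<close>.\<close>

definition do_ring :: "('a::comm_ring_1 \<Rightarrow> 'a) \<Rightarrow> 'a fls ring" where
  "do_ring d = (pdo_ring d)\<lparr>carrier := {F. \<forall>i>0. fls_nth F i = 0}\<rparr>"


section \<open>Group actions and cocycles\<close>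

text \<open>\<open>\<sigma> \<gamma> b\<close> stands for \<open>b \<cdot> \<gamma>\<close>; the actions are right actions.\<close>

definition right_action_by_auts ::
  "('g, 'm) monoid_scheme \<Rightarrow> ('b, 'n) ring_scheme \<Rightarrow> ('g \<Rightarrow> 'b \<Rightarrow> 'b) \<Rightarrow> bool" where
  "right_action_by_auts \<Gamma> S \<sigma> \<longleftrightarrow>
     (\<forall>\<gamma>\<in>carrier \<Gamma>. \<sigma> \<gamma> \<in> ring_iso S S) \<and>
     (\<forall>b\<in>carrier S. \<sigma> \<one>\<^bsub>\<Gamma>\<^esub> b = b) \<and>
     (\<forall>\<gamma>\<in>carrier \<Gamma>. \<forall>\<gamma>'\<in>carrier \<Gamma>. \<forall>b\<in>carrier S.
        \<sigma> \<gamma>' (\<sigma> \<gamma> b) = \<sigma> (\<gamma> \<otimes>\<^bsub>\<Gamma>\<^esub> \<gamma>') b)"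

text \<open>\<open>S\<close> is one of the rings \<open>pdo_ring d\<close>, \<open>do_ring d\<close>, both containing the constants.\<close>

definition extends_action ::
  "('g, 'm) monoid_scheme \<Rightarrow> ('a::comm_ring_1 fls, 'n) ring_scheme \<Rightarrow>
   ('g \<Rightarrow> 'a \<Rightarrow> 'a) \<Rightarrow> ('g \<Rightarrow> 'a fls \<Rightarrow> 'a fls) \<Rightarrow> bool" where
  "extends_action \<Gamma> S act \<sigma> \<longleftrightarrow>
     right_action_by_auts \<Gamma> S \<sigma> \<and>
     (\<forall>\<gamma>\<in>carrier \<Gamma>. \<forall>f. \<sigma> \<gamma> (fls_const f) = fls_const (act \<gamma> f))"

abbreviation unit_group :: "'a::comm_ring_1 set" where
  "unit_group \<equiv> Units (ring_of_type_algebra :: 'a ring)"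

definition cocycles1 ::
  "('g, 'm) monoid_scheme \<Rightarrow> ('g \<Rightarrow> 'a \<Rightarrow> 'a) \<Rightarrow> ('g \<Rightarrow> 'a::comm_ring_1) set" where
  "cocycles1 \<Gamma> act =
     {s \<in> carrier \<Gamma> \<rightarrow> unit_group. \<forall>\<gamma>\<in>carrier \<Gamma>. \<forall>\<gamma>'\<in>carrier \<Gamma>.
        s (\<gamma> \<otimes>\<^bsub>\<Gamma>\<^esub> \<gamma>') = act \<gamma>' (s \<gamma>) * s \<gamma>'}"

definition d_compatible ::
  "('g, 'm) monoid_scheme \<Rightarrow> ('g \<Rightarrow> 'a \<Rightarrow> 'a) \<Rightarrow> ('a::comm_ring_1 \<Rightarrow> 'a) \<Rightarrow> bool" where
  "d_compatible \<Gamma> act d \<longleftrightarrow>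
     (\<forall>\<gamma>\<in>carrier \<Gamma>. \<exists>u\<in>unit_group. \<forall>f. act \<gamma> (d f) = u * d (act \<gamma> f))"

text \<open>
  \<open>p\<close> is the map associated to the \<open>d\<close>-compatibility; for \<open>d \<noteq> 0\<close> over a domain its values on
  \<open>carrier \<Gamma>\<close> are uniquely determined.
\<close>

definition compatibility_map ::
  "('g, 'm) monoid_scheme \<Rightarrow> ('g \<Rightarrow> 'a \<Rightarrow> 'a) \<Rightarrow> ('a::comm_ring_1 \<Rightarrow> 'a) \<Rightarrow> ('g \<Rightarrow> 'a) \<Rightarrow> bool"
  where
  "compatibility_map \<Gamma> act d p \<longleftrightarrow>
     (\<forall>\<gamma>\<in>carrier \<Gamma>. p \<gamma> \<in> unit_group \<and> (\<forall>f. act \<gamma> (d f) = p \<gamma> * d (act \<gamma> f)))"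

definition twisted_map ::
  "('g, 'm) monoid_scheme \<Rightarrow> ('g \<Rightarrow> 'a \<Rightarrow> 'a) \<Rightarrow> ('g \<Rightarrow> 'a::comm_ring_1) \<Rightarrow> ('g \<Rightarrow> 'a) \<Rightarrow> bool"
  where
  "twisted_map \<Gamma> act p r \<longleftrightarrow>
     (\<forall>\<gamma>\<in>carrier \<Gamma>. \<forall>\<gamma>'\<in>carrier \<Gamma>.
        r (\<gamma> \<otimes>\<^bsub>\<Gamma>\<^esub> \<gamma>') = r \<gamma>' + inv\<^bsub>ring_of_type_algebra\<^esub> (p \<gamma>') * act \<gamma>' (r \<gamma>))"

definition given_on_x_inv ::
  "('g, 'm) monoid_scheme \<Rightarrow> ('a::comm_ring_1 \<Rightarrow> 'a) \<Rightarrow> ('g \<Rightarrow> 'a) \<Rightarrow> ('g \<Rightarrow> 'a) \<Rightarrow>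
   ('g \<Rightarrow> 'a fls \<Rightarrow> 'a fls) \<Rightarrow> bool" where
  "given_on_x_inv \<Gamma> d p r \<sigma> \<longleftrightarrow>
     (\<forall>\<gamma>\<in>carrier \<Gamma>. \<sigma> \<gamma> fls_X_inv =
        fls_const (p \<gamma>) \<otimes>\<^bsub>pdo_ring d\<^esub> fls_X_inv \<oplus>\<^bsub>pdo_ring d\<^esub> fls_const (p \<gamma> * r \<gamma>))"


section \<open>The product of \<open>pdo_ring\<close> satisfies the defining commutation rules\<close>

lemma derivation_0: "derivation d \<Longrightarrow> d 0 = 0"
proof -
  assume "derivation d"
  hence "d (0 + 0) = d 0 + d 0"
    unfolding derivation_def by blast
  thus "d 0 = 0" by simp
qed

lemma derivation_funpow_0: "derivation d \<Longrightarrow> (d ^^ n) 0 = 0"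
  by (induction n) (auto simp: derivation_0)

lemma finite_pdo_index:
  "finite {(i, n). fls_nth F i \<noteq> 0 \<and> fls_nth G (k - i - int n) \<noteq> 0}"
proof (rule finite_subset)
  let ?a = "fls_subdegree F" and ?b = "fls_subdegree G"
  show "{(i, n). fls_nth F i \<noteq> 0 \<and> fls_nth G (k - i - int n) \<noteq> 0} \<subseteq>
      {?a..k - ?b} \<times> {..nat (k - ?a - ?b)}"
  proof
    fix z assume "z \<in> {(i, n). fls_nth F i \<noteq> 0 \<and> fls_nth G (k - i - int n) \<noteq> 0}"
    then obtain i n where z: "z = (i, n)" "fls_nth F i \<noteq> 0" "fls_nth G (k - i - int n) \<noteq> 0"
      by blast
    hence "?a \<le> i" "?b \<le> k - i - int n"
      by (auto intro: fls_subdegree_leI)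
    thus "z \<in> {?a..k - ?b} \<times> {..nat (k - ?a - ?b)}"
      unfolding z by auto
  qed
qed auto

lemma pdo_mult_nth:
  "fls_nth (pdo_mult d F G) k =
     (\<Sum>(i, n) | fls_nth F i \<noteq> 0 \<and> fls_nth G (k - i - int n) \<noteq> 0.
       fls_nth F i * of_int (pdo_coeff i n) * (d ^^ n) (fls_nth G (k - i - int n)))"
  unfolding pdo_mult_def
proof (rule nth_Abs_fls_lower_bound[of "fls_subdegree F + fls_subdegree G"], safe)
  fix k assume k: "k < fls_subdegree F + fls_subdegree G"
  have "{(i, n). fls_nth F i \<noteq> 0 \<and> fls_nth G (k - i - int n) \<noteq> 0} = {}"
  proof safe
    fix i n assume "fls_nth F i \<noteq> 0" "fls_nth G (k - i - int n) \<noteq> 0"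
    hence "fls_subdegree F \<le> i" "fls_subdegree G \<le> k - i - int n"
      by (auto intro: fls_subdegree_leI)
    with k show "(i, n) \<in> {}" by auto
  qed
  thus "(\<Sum>(i, n) | fls_nth F i \<noteq> 0 \<and> fls_nth G (k - i - int n) \<noteq> 0.
       fls_nth F i * of_int (pdo_coeff i n) * (d ^^ n) (fls_nth G (k - i - int n))) = 0"
    by (simp only: sum.empty)
qed

lemma pdo_mult_const_left_nth:
  assumes "derivation d"
  shows "fls_nth (pdo_mult d (fls_const c) G) k = c * fls_nth G k"
proof -
  have *: "pdo_coeff 0 n = (if n = 0 then 1 else 0)" for n
    by (auto simp: pdo_coeff_def binomial_eq_0)
  have "fls_nth (pdo_mult d (fls_const c) G) k =
      (\<Sum>z\<in>{(i, n). fls_nth (fls_const c) i \<noteq> 0 \<and> fls_nth G (k - i - int n) \<noteq> 0}.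
        if z = (0, 0) then c * fls_nth G k else 0)"
    unfolding pdo_mult_nth by (rule sum.cong) (auto simp: * split: if_splits)
  also have "\<dots> = c * fls_nth G k"
    by (subst sum.delta[OF finite_pdo_index]) auto
  finally show ?thesis .
qed

text \<open>\<open>x f = \<Sum>n\<ge>0. d\<^sup>n(f) x\<^sup>n\<^sup>+\<^sup>1\<close>\<close>

lemma pdo_mult_X_const_nth:
  assumes "derivation d"
  shows "fls_nth (pdo_mult d fls_X (fls_const f)) k = (if k \<ge> 1 then (d ^^ nat (k - 1)) f else 0)"
proof -
  have *: "pdo_coeff 1 n = 1" for n
    by (simp add: pdo_coeff_def)
  have "{(i, n). fls_nth (fls_X :: 'a fls) i \<noteq> 0 \<and> fls_nth (fls_const f) (k - i - int n) \<noteq> 0} =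
      (if k \<ge> 1 \<and> f \<noteq> 0 then {(1, nat (k - 1))} else {})"
    by (auto split: if_splits)
  thus ?thesis
    unfolding pdo_mult_nth using derivation_funpow_0[OF assms] by (auto simp: *)
qed

text \<open>\<open>x\<^sup>-\<^sup>1 f = f x\<^sup>-\<^sup>1 - d(f)\<close>\<close>

lemma pdo_mult_X_inv_const:
  assumes "derivation d"
  shows "pdo_mult d fls_X_inv (fls_const f) = pdo_mult d (fls_const f) fls_X_inv - fls_const (d f)"
proof (rule fls_eqI)
  fix k
  have *: "pdo_coeff (-1) n = (if n = 0 then 1 else if n = 1 then -1 else 0)" for n
    by (auto simp: pdo_coeff_def binomial_eq_0)
  have "{(i, n). fls_nth (fls_X_inv :: 'a fls) i \<noteq> 0 \<and> fls_nth (fls_const f) (k - i - int n) \<noteq> 0} =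
      (if k \<ge> -1 \<and> f \<noteq> 0 then {(-1, nat (k + 1))} else {})"
    by (auto split: if_splits)
  thus "fls_nth (pdo_mult d fls_X_inv (fls_const f)) k =
        fls_nth (pdo_mult d (fls_const f) fls_X_inv - fls_const (d f)) k"
    unfolding fls_minus_nth pdo_mult_const_left_nth[OF assms] unfolding pdo_mult_nth
    using derivation_0[OF assms] by (auto simp: *)
qed

lemma pdo_mult_X_X_inv:
  assumes "derivation d"
  shows "pdo_mult d fls_X fls_X_inv = 1" "pdo_mult d fls_X_inv fls_X = 1"
proof -
  have d1: "d 1 = 0"
  proof -
    have "d (1 * 1) = d 1 * 1 + 1 * d 1"
      using assms unfolding derivation_def by blast
    thus ?thesis by simp
  qed
  have dn: "(d ^^ n) 1 = (if n = 0 then 1 else 0)" for n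
  proof (induction n)
    case (Suc n)
    thus ?case using d1 derivation_0[OF assms] by (cases n) auto
  qed simp
  have c0: "pdo_coeff i 0 = 1" for i
    by (simp add: pdo_coeff_def)
  have "{(i, n). fls_nth (fls_X :: 'a fls) i \<noteq> 0 \<and> fls_nth (fls_X_inv :: 'a fls) (k - i - int n) \<noteq> 0} =
      (if k \<ge> 0 then {(1, nat k)} else {})" for k
    by (auto split: if_splits)
  thus "pdo_mult d fls_X fls_X_inv = 1"
    by (intro fls_eqI) (auto simp: pdo_mult_nth dn c0)
  have "{(i, n). fls_nth (fls_X_inv :: 'a fls) i \<noteq> 0 \<and> fls_nth (fls_X :: 'a fls) (k - i - int n) \<noteq> 0} =
      (if k \<ge> 0 then {(-1, nat k)} else {})" for k
    by (auto split: if_splits)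
  thus "pdo_mult d fls_X_inv fls_X = 1"
    by (intro fls_eqI) (auto simp: pdo_mult_nth dn c0)
qed

end

theory Submission
  imports Defs
begin

text \<open>
  Necessity. In \<open>B\<close> and in \<open>A\<close> the commutator of \<open>x\<^sup>-\<^sup>1\<close> with every \<open>f \<in> R\<close> is the constant \<open>-d(f)\<close>,
  and since an extended automorphism maps \<open>R\<close> onto \<open>R\<close>, the image \<open>Y\<close> of \<open>x\<^sup>-\<^sup>1\<close> also has only constant
  commutators with elements of \<open>R\<close>. A term \<open>z x\<^sup>m\<close> contributes \<open>m z d(f) x\<^sup>m\<^sup>+\<^sup>1\<close> to the commutator, so in
  characteristic zero with \<open>d \<noteq> 0\<close> a lowest term survives outside degree \<open>0\<close> unless \<open>m\<close> is \<open>-1\<close> or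
  \<open>0\<close>; therefore \<open>Y = p x\<^sup>-\<^sup>1 + q\<close> (\<open>degree_one_if_constant_commutators\<close>). The commutator of
  \<open>p x\<^sup>-\<^sup>1 + q\<close> with \<open>f \<cdot> \<gamma>\<close> is \<open>-p d(f \<cdot> \<gamma>)\<close>, which gives \<open>d(f) \<cdot> \<gamma> = p d(f \<cdot> \<gamma>)\<close>. The factors \<open>p\<close> obey the
  cocycle rule because \<open>d \<noteq> 0\<close>, and this makes them units. With \<open>q = p r\<close>, the rule for \<open>r\<close> compares the
  constant terms of the images of \<open>x\<^sup>-\<^sup>1\<close> under \<open>\<gamma>\<close> followed by \<open>\<gamma>'\<close> and under \<open>\<gamma>\<gamma>'\<close> (\<open>twisted_step_iff\<close>).

  Sufficiency. If \<open>p\<close> is a unit, \<open>p x\<^sup>-\<^sup>1 + q\<close> has an inverse \<open>w\<close> of order \<open>1\<close>, and the extension is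
  \<open>\<Sum>i f\<^sub>i x\<^sup>i \<mapsto> \<Sum>i (f\<^sub>i \<cdot> \<gamma>) w\<^sup>i\<close> (\<open>extension_exists\<close>). Neither the multiplicativity of this map nor the
  associativity of \<open>B\<close> requires identities between binomial coefficients beyond Pascal's rule. In both
  cases the elements that satisfy the identity as left factor include \<open>R\<close> and \<open>x\<^sup>-\<^sup>1\<close>; since left
  multiplication by \<open>x\<^sup>-\<^sup>1\<close> is injective they include \<open>x\<close>, hence all monomials; and both sides are additive
  and continuous in the left factor, so that agreement on monomials suffices
  (\<open>continuous_additive_eqI\<close>). The extension maps polynomials in \<open>x\<^sup>-\<^sup>1\<close> to polynomials in \<open>x\<^sup>-\<^sup>1\<close>, which
  gives the action on \<open>A\<close>.

  Uniqueness. A continuous ring endomorphism of \<open>B\<close> is determined by its values on \<open>R\<close> and \<open>x\<^sup>-\<^sup>1\<close>, but an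
  arbitrary extension is not continuous by assumption. It is so automatically
  (\<open>pdo_hom_continuous\<close>): because \<open>1/2 \<in> R\<close>, every \<open>1 + F\<close> with \<open>F\<close> of positive order has a square root of
  the same form, so the order of its image is divisible by every power of two and must vanish.
\<close>

section \<open>The order filtration and density of the monomials\<close>

definition order_ge :: "int \<Rightarrow> 'a::zero fls set" where
  "order_ge N = {F. \<forall>k<N. fls_nth F k = 0}"

definition monomial :: "'a::zero \<Rightarrow> int \<Rightarrow> 'a fls" where
  "monomial f i = fls_shift (- i) (fls_const f)"

lemma nth_monomial [simp]: "fls_nth (monomial f i) k = (if k = i then f else 0)"
  by (simp add: monomial_def)

lemma monomial_degree_0: "monomial f 0 = fls_const f"
  by (simp add: monomial_def)

lemma monomial_X_inv: "monomial 1 (-1) = fls_X_inv"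
  by (rule fls_eqI) simp

lemma order_geI: "(\<And>k. k < N \<Longrightarrow> fls_nth F k = 0) \<Longrightarrow> F \<in> order_ge N"
  by (simp add: order_ge_def)

lemma order_geD: "F \<in> order_ge N \<Longrightarrow> k < N \<Longrightarrow> fls_nth F k = 0"
  by (simp add: order_ge_def)

lemma order_ge_subdegree: "F \<in> order_ge (fls_subdegree F)"
  by (simp add: order_ge_def)

lemma order_ge_antimono: "F \<in> order_ge N \<Longrightarrow> M \<le> N \<Longrightarrow> F \<in> order_ge M"
  by (simp add: order_ge_def)

lemma order_ge_common:
  obtains a where "F \<in> order_ge a" "G \<in> order_ge a"
  using order_ge_antimono[OF order_ge_subdegree[of F], of "min (fls_subdegree F) (fls_subdegree G)"]
    order_ge_antimono[OF order_ge_subdegree[of G], of "min (fls_subdegree F) (fls_subdegree G)"]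
  by force

lemma order_ge_0 [simp]: "0 \<in> order_ge N"
  by (simp add: order_ge_def)

lemma order_ge_const: "fls_const c \<in> order_ge 0"
  by (simp add: order_ge_def)

lemma order_ge_1: "1 \<in> order_ge 0"
  by (simp add: order_ge_def)

lemma order_ge_monomial: "monomial f i \<in> order_ge i"
  by (simp add: order_ge_def)

lemma order_ge_add: "F \<in> order_ge N \<Longrightarrow> G \<in> order_ge N \<Longrightarrow> F + G \<in> order_ge N"
  for F G :: "'a::comm_ring_1 fls"
  by (simp add: order_ge_def)

lemma order_ge_minus: "F \<in> order_ge N \<Longrightarrow> G \<in> order_ge N \<Longrightarrow> F - G \<in> order_ge N"
  for F G :: "'a::comm_ring_1 fls"
  by (simp add: order_ge_def)

lemma nth_sum_fls: "fls_nth (\<Sum>i\<in>A. F i) k = (\<Sum>i\<in>A. fls_nth (F i) k)"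
  for F :: "'i \<Rightarrow> 'a::comm_ring_1 fls"
  by (induction A rule: infinite_finite_induct) auto

lemma eq_if_diff_order_ge:
  fixes F G :: "'a::comm_ring_1 fls"
  assumes "\<And>M. F - G \<in> order_ge M"
  shows "F = G"
proof (rule fls_eqI)
  fix k
  show "fls_nth F k = fls_nth G k"
    using order_geD[OF assms[of "k + 1"], of k] by simp
qed

lemma monomial_expansion:
  fixes F :: "'a::comm_ring_1 fls"
  assumes "F \<in> order_ge a" "\<And>k. k > b \<Longrightarrow> fls_nth F k = 0"
  shows "F = (\<Sum>i\<in>{a..b}. monomial (fls_nth F i) i)"
proof (rule fls_eqI)
  fix k
  have "(\<Sum>i\<in>{a..b}. fls_nth (monomial (fls_nth F i) i) k) = (if k \<in> {a..b} then fls_nth F k else 0)"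
    by simp
  also have "\<dots> = fls_nth F k"
    using assms(2)[of k] order_geD[OF assms(1), of k] by auto
  finally show "fls_nth F k = fls_nth (\<Sum>i\<in>{a..b}. monomial (fls_nth F i) i) k"
    by (simp only: nth_sum_fls)
qed

text \<open>
  Continuity is with respect to the topology in which the sets \<open>order_ge N\<close> form a basis of
  neighbourhoods of \<open>0\<close>.
\<close>

definition continuous_additive :: "('a::comm_ring_1 fls \<Rightarrow> 'a fls) \<Rightarrow> bool" where
  "continuous_additive \<phi> \<longleftrightarrow>
     (\<forall>F G. \<phi> (F + G) = \<phi> F + \<phi> G) \<and> (\<forall>M. \<exists>N. \<forall>F\<in>order_ge N. \<phi> F \<in> order_ge M)"

lemma continuous_additiveI:
  assumes "\<And>F G. \<phi> (F + G) = \<phi> F + \<phi> G"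
    and "\<And>N F. F \<in> order_ge N \<Longrightarrow> \<phi> F \<in> order_ge (N + c)"
  shows "continuous_additive \<phi>"
  unfolding continuous_additive_def
proof (intro conjI allI)
  show "\<exists>N. \<forall>F\<in>order_ge N. \<phi> F \<in> order_ge M" for M
    using assms(2)[of _ "M - c"] by auto
qed (fact assms(1))

lemma additive_zero: "(\<And>F G. \<phi> (F + G) = \<phi> F + \<phi> G) \<Longrightarrow> \<phi> 0 = 0"
  for \<phi> :: "'a::ab_group_add \<Rightarrow> 'b::ab_group_add"
  by (metis add_cancel_right_left)

lemma additive_diff: "(\<And>F G. \<phi> (F + G) = \<phi> F + \<phi> G) \<Longrightarrow> \<phi> (F - G) = \<phi> F - \<phi> G"
  for \<phi> :: "'a::ab_group_add \<Rightarrow> 'b::ab_group_add"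
  by (metis add_diff_cancel diff_add_cancel)

lemma additive_sum: "(\<And>F G. \<phi> (F + G) = \<phi> F + \<phi> G) \<Longrightarrow> \<phi> (\<Sum>i\<in>A. F i) = (\<Sum>i\<in>A. \<phi> (F i))"
  for \<phi> :: "'a::ab_group_add \<Rightarrow> 'b::ab_group_add"
  by (induction A rule: infinite_finite_induct) (simp_all add: additive_zero)

lemma continuous_additive_compose:
  assumes "continuous_additive \<phi>" "continuous_additive \<psi>"
  shows "continuous_additive (\<lambda>F. \<phi> (\<psi> F))"
  using assms unfolding continuous_additive_def by metis

lemma continuous_additive_eqI:
  assumes \<phi>: "continuous_additive \<phi>" and \<psi>: "continuous_additive \<psi>"
    and eq: "\<And>f i. \<phi> (monomial f i) = \<psi> (monomial f i)"
  shows "\<phi> F = \<psi> F"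
proof (rule eq_if_diff_order_ge)
  fix M
  have add: "\<And>F G. \<phi> (F + G) = \<phi> F + \<phi> G" "\<And>F G. \<psi> (F + G) = \<psi> F + \<psi> G"
    using \<phi> \<psi> by (auto simp: continuous_additive_def)
  obtain N1 N2 where N: "\<And>F. F \<in> order_ge N1 \<Longrightarrow> \<phi> F \<in> order_ge M"
      "\<And>F. F \<in> order_ge N2 \<Longrightarrow> \<psi> F \<in> order_ge M"
    using \<phi> \<psi> unfolding continuous_additive_def by metis
  define N where "N = max N1 N2"
  define H where "H = (\<Sum>i\<in>{fls_subdegree F..N}. monomial (fls_nth F i) i)"
  have "fls_nth H k = fls_nth F k" if "k \<le> N" for k
    using that by (simp add: H_def nth_sum_fls)
  hence tail: "F - H \<in> order_ge N"
    by (auto intro!: order_geI)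
  have "\<phi> H = \<psi> H"
    unfolding H_def by (simp add: additive_sum[of \<phi>] additive_sum[of \<psi>] add eq)
  hence "\<phi> F - \<psi> F = \<phi> (F - H) - \<psi> (F - H)"
    by (simp add: additive_diff[of \<phi>] additive_diff[of \<psi>] add)
  moreover have "\<phi> (F - H) \<in> order_ge M" "\<psi> (F - H) \<in> order_ge M"
    using tail by (auto intro!: N order_ge_antimono[OF tail] simp: N_def)
  ultimately show "\<phi> F - \<psi> F \<in> order_ge M"
    by (simp add: order_ge_minus)
qed

text \<open>
  Equations between series are solved by successive approximation: one more coefficient becomes
  correct in each step.
\<close>

lemma contraction_fixpoint:
  fixes T :: "'a::comm_ring_1 fls \<Rightarrow> 'a fls"
  assumes closed: "\<And>H. H \<in> order_ge a \<Longrightarrow> T H \<in> order_ge a"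
    and contr: "\<And>H H' k. H \<in> order_ge a \<Longrightarrow> H' \<in> order_ge a \<Longrightarrow> H - H' \<in> order_ge k \<Longrightarrow>
      T H - T H' \<in> order_ge (k + 1)"
  shows "\<exists>H\<in>order_ge a. T H = H"
proof -
  define h where "h n = (T ^^ n) 0" for n
  have h_ge: "h n \<in> order_ge a" for n
    by (induction n) (auto simp: h_def closed)
  have step: "h (Suc n) - h n \<in> order_ge (a + int n)" for n
  proof (induction n)
    case 0
    show ?case using h_ge[of 1] by (simp add: h_def)
  next
    case (Suc n)
    show ?case
      using contr[OF h_ge h_ge Suc.IH] by (simp add: h_def ac_simps)
  qed
  have stable: "fls_nth (h (n + m)) k = fls_nth (h n) k" if "k < a + int n" for n m k
  proof (induction m)
    case (Suc m)
    have "k < a + int (n + m)"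
      using that by simp
    from order_geD[OF step this] show ?case
      using Suc.IH by simp
  qed simp
  define H where "H = Abs_fls (\<lambda>k. fls_nth (h (nat (k - a + 1))) k)"
  have nth_H: "fls_nth H k = fls_nth (h (nat (k - a + 1))) k" for k
    unfolding H_def
    by (rule nth_Abs_fls_lower_bound[of a]) (use order_geD[OF h_ge] in blast)
  have H_ge: "H \<in> order_ge a"
    by (rule order_geI) (use nth_H order_geD[OF h_ge] in auto)
  have approx: "H - h n \<in> order_ge (a + int n)" for n
  proof (rule order_geI)
    fix k assume k: "k < a + int n"
    show "fls_nth (H - h n) k = 0"
    proof (cases "k < a")
      case True
      thus ?thesis using order_geD[OF H_ge] order_geD[OF h_ge] by simp
    next
      case False
      define m where "m = nat (k - a + 1)"
      have "n = m + (n - m)" "k < a + int m"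
        using k False by (auto simp: m_def)
      with stable[of k m "n - m"] show ?thesis
        by (simp add: nth_H m_def)
    qed
  qed
  have "T H = H"
  proof (rule eq_if_diff_order_ge)
    fix M
    define n where "n = nat (M - a)"
    have "T H - h (Suc n) \<in> order_ge (a + int n + 1)"
      using contr[OF H_ge h_ge approx[of n]] by (simp add: h_def)
    hence "T H - h (Suc n) - (H - h (Suc n)) \<in> order_ge (a + int n + 1)"
      using approx[of "Suc n"] by (intro order_ge_minus[of "T H - h (Suc n)"]) (simp_all add: ac_simps)
    hence "T H - H \<in> order_ge (a + int n + 1)"
      by simp
    thus "T H - H \<in> order_ge M"
      by (rule order_ge_antimono) (auto simp: n_def)
  qed
  with H_ge show ?thesis by blast
qed

section \<open>The ring of formal pseudodifferential operators\<close>

lemma pdo_coeff_0: "pdo_coeff i 0 = 1"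
  by (simp add: pdo_coeff_def)

lemma pdo_coeff_1: "pdo_coeff i 1 = i"
  by (simp add: pdo_coeff_def)

text \<open>Pascal's rule, in the form that expresses \<open>x\<^sup>-\<^sup>1 x\<^sup>i = x\<^sup>i\<^sup>-\<^sup>1\<close>.\<close>

lemma pdo_coeff_Pascal: "pdo_coeff i (Suc n) - pdo_coeff i n = pdo_coeff (i - 1) (Suc n)"
proof (cases "i > 1")
  case True
  define m where "m = nat i - 2"
  have "nat i = m + 2" "nat (i - 1) = m + 1"
    using True by (auto simp: m_def)
  moreover have "(m + 2 + n) choose Suc n = ((m + 1 + n) choose n) + ((m + 1 + n) choose Suc n)"
    using binomial_Suc_Suc[of "m + 1 + n" n] by simp
  ultimately show ?thesis
    using True by (simp add: pdo_coeff_def)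
next
  case False
  show ?thesis
  proof (cases "i = 1")
    case True
    thus ?thesis by (simp add: pdo_coeff_def)
  next
    case False
    define m where "m = nat (- i)"
    have "nat (- (i - 1)) = Suc m"
      using False \<open>\<not> i > 1\<close> by (auto simp: m_def)
    thus ?thesis
      using False \<open>\<not> i > 1\<close> by (simp add: pdo_coeff_def m_def algebra_simps)
  qed
qed

locale differential_ring =
  fixes d :: "'a::comm_ring_1 \<Rightarrow> 'a"
  assumes deriv: "derivation d"
begin

abbreviation pdo_prod (infixl \<open>\<star>\<close> 70) where "F \<star> G \<equiv> pdo_mult d F G"

lemma d_add: "d (f + g) = d f + d g" and d_mult: "d (f * g) = d f * g + f * d g"
  using deriv unfolding derivation_def by blast+

lemma d_0 [simp]: "d 0 = 0"
  by (rule derivation_0[OF deriv])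

lemma d_1 [simp]: "d 1 = 0"
  using d_mult[of 1 1] by simp

lemma d_diff: "d (f - g) = d f - d g"
  by (rule additive_diff) (rule d_add)

lemma d_sum: "d (\<Sum>i\<in>A. f i) = (\<Sum>i\<in>A. d (f i))"
  by (rule additive_sum) (rule d_add)

lemma d_of_int_mult: "d (of_int m * f) = of_int m * d f"
proof -
  have "d (of_nat n) = 0" for n
    by (induction n) (simp_all add: d_add)
  hence "d (of_int m) = 0"
    by (cases m rule: int_diff_cases) (simp add: d_diff)
  thus ?thesis by (simp add: d_mult)
qed

lemma dn_0 [simp]: "(d ^^ n) 0 = 0"
  by (rule derivation_funpow_0[OF deriv])

lemma dn_add: "(d ^^ n) (f + g) = (d ^^ n) f + (d ^^ n) g"
  by (induction n) (simp_all add: d_add)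

lemma dn_1: "(d ^^ n) 1 = (if n = 0 then 1 else 0)"
  by (induction n) auto

text \<open>
  The index set of the defining sum depends on the supports of the factors. A box that depends only
  on bounds for their orders makes sums for different factors comparable.
\<close>

lemma nth_mult_box:
  assumes F: "F \<in> order_ge a" and G: "G \<in> order_ge b"
  shows "fls_nth (F \<star> G) k =
    (\<Sum>(i, n)\<in>{a..k - b} \<times> {..nat (k - a - b)}.
      fls_nth F i * of_int (pdo_coeff i n) * (d ^^ n) (fls_nth G (k - i - int n)))"
  unfolding pdo_mult_nth
proof (rule sum.mono_neutral_left)
  show "{(i, n). fls_nth F i \<noteq> 0 \<and> fls_nth G (k - i - int n) \<noteq> 0}
      \<subseteq> {a..k - b} \<times> {..nat (k - a - b)}"
  proof
    fix z assume "z \<in> {(i, n). fls_nth F i \<noteq> 0 \<and> fls_nth G (k - i - int n) \<noteq> 0}"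
    then obtain i n where z: "z = (i, n)" "fls_nth F i \<noteq> 0" "fls_nth G (k - i - int n) \<noteq> 0"
      by blast
    hence "a \<le> i" "b \<le> k - i - int n"
      using order_geD[OF F, of i] order_geD[OF G, of "k - i - int n"] by (meson not_le)+
    thus "z \<in> {a..k - b} \<times> {..nat (k - a - b)}"
      unfolding z by auto
  qed
qed auto

lemma mult_add_left: "(F + F') \<star> G = F \<star> G + F' \<star> G"
proof (rule fls_eqI)
  fix k
  obtain a where a: "F \<in> order_ge a" "F' \<in> order_ge a"
    by (rule order_ge_common)
  show "fls_nth ((F + F') \<star> G) k = fls_nth (F \<star> G + F' \<star> G) k"
    by (simp add: nth_mult_box[OF a(1) order_ge_subdegree] nth_mult_box[OF a(2) order_ge_subdegree]
        nth_mult_box[OF order_ge_add[OF a] order_ge_subdegree]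
        case_prod_unfold sum.distrib algebra_simps)
qed

lemma mult_add_right: "F \<star> (G + G') = F \<star> G + F \<star> G'"
proof (rule fls_eqI)
  fix k
  obtain a where a: "G \<in> order_ge a" "G' \<in> order_ge a"
    by (rule order_ge_common)
  show "fls_nth (F \<star> (G + G')) k = fls_nth (F \<star> G + F \<star> G') k"
    by (simp add: nth_mult_box[OF order_ge_subdegree a(1)] nth_mult_box[OF order_ge_subdegree a(2)]
        nth_mult_box[OF order_ge_subdegree order_ge_add[OF a]] dn_add
        case_prod_unfold sum.distrib algebra_simps)
qed

lemma mult_order_ge:
  assumes F: "F \<in> order_ge a" and G: "G \<in> order_ge b"
  shows "F \<star> G \<in> order_ge (a + b)"
proof (rule order_geI)
  fix k assume "k < a + b"
  hence empty: "{a..k - b} = {}" by simp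
  show "fls_nth (F \<star> G) k = 0"
    unfolding nth_mult_box[OF F G] empty by simp
qed

lemma mult_diff_left: "(F - F') \<star> G = F \<star> G - F' \<star> G"
  by (rule additive_diff[of "\<lambda>F. F \<star> G"]) (rule mult_add_left)

lemma mult_diff_right: "F \<star> (G - G') = F \<star> G - F \<star> G'"
  by (rule additive_diff) (rule mult_add_right)

lemma mult_zero_left [simp]: "0 \<star> G = 0"
  by (simp add: pdo_mult_nth fls_eq_iff)

lemma continuous_additive_mult_left: "continuous_additive (\<lambda>G. F \<star> G)"
  by (rule continuous_additiveI[where c = "fls_subdegree F"])
    (use mult_add_right mult_order_ge[OF order_ge_subdegree] in \<open>auto simp: add.commute\<close>)

lemma continuous_additive_mult_right: "continuous_additive (\<lambda>F. F \<star> G)"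
  by (rule continuous_additiveI[where c = "fls_subdegree G"])
    (use mult_add_left mult_order_ge[OF _ order_ge_subdegree] in auto)

lemma nth_const_mult [simp]: "fls_nth (fls_const c \<star> G) k = c * fls_nth G k"
  by (rule pdo_mult_const_left_nth[OF deriv])

lemma const_mult_assoc: "(fls_const c \<star> G) \<star> H = fls_const c \<star> (G \<star> H)"
proof (rule fls_eqI)
  fix k
  have G: "fls_const c \<star> G \<in> order_ge (fls_subdegree G)"
    using mult_order_ge[OF order_ge_const order_ge_subdegree] by simp
  show "fls_nth ((fls_const c \<star> G) \<star> H) k = fls_nth (fls_const c \<star> (G \<star> H)) k"
    unfolding nth_const_mult[of c "G \<star> H"] nth_mult_box[OF G order_ge_subdegree]
      nth_mult_box[OF order_ge_subdegree[of G] order_ge_subdegree]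
    by (simp add: case_prod_unfold sum_distrib_left mult.assoc)
qed

lemma mult_1_left [simp]: "1 \<star> G = G"
  using nth_const_mult[of 1 G] by (intro fls_eqI) simp

lemma monomial_eq_const_mult: "monomial f i = fls_const f \<star> monomial 1 i"
  by (rule fls_eqI) simp

text \<open>
  The number \<open>N\<close> of summands is left free, so that expansions for different coefficients can be
  compared.
\<close>

lemma nth_monomial_mult:
  assumes G: "G \<in> order_ge b" and N: "k - i - b \<le> int N"
  shows "fls_nth (monomial f i \<star> G) k =
    (\<Sum>n\<le>N. f * of_int (pdo_coeff i n) * (d ^^ n) (fls_nth G (k - i - int n)))"
proof -
  let ?t = "\<lambda>i' n. fls_nth (monomial f i) i' * of_int (pdo_coeff i' n)
    * (d ^^ n) (fls_nth G (k - i' - int n))"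
  let ?u = "\<lambda>n. f * of_int (pdo_coeff i n) * (d ^^ n) (fls_nth G (k - i - int n))"
  show ?thesis
  proof (cases "i \<le> k - b")
    case True
    have "fls_nth (monomial f i \<star> G) k = (\<Sum>i'\<in>{i..k - b}. \<Sum>n\<le>nat (k - i - b). ?t i' n)"
      by (simp only: nth_mult_box[OF order_ge_monomial G] sum.cartesian_product)
    also have "\<dots> = (\<Sum>i'\<in>{i..k - b}. if i' = i then \<Sum>n\<le>nat (k - i - b). ?u n else 0)"
      by (intro sum.cong) auto
    also have "\<dots> = (\<Sum>n\<le>nat (k - i - b). ?u n)"
      using True by simp
    also have "\<dots> = (\<Sum>n\<le>N. ?u n)"
    proof (rule sum.mono_neutral_left)
      show "\<forall>n\<in>{..N} - {..nat (k - i - b)}. ?u n = 0"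
      proof
        fix n assume "n \<in> {..N} - {..nat (k - i - b)}"
        hence "k - i - int n < b"
          using True by auto
        thus "?u n = 0"
          by (simp add: order_geD[OF G])
      qed
      show "{..nat (k - i - b)} \<subseteq> {..N}"
        using N by (simp add: nat_le_iff)
    qed auto
    finally show ?thesis .
  next
    case False
    have "monomial f i \<star> G \<in> order_ge (i + b)"
      by (rule mult_order_ge[OF order_ge_monomial G])
    hence "fls_nth (monomial f i \<star> G) k = 0"
      using False by (intro order_geD) auto
    moreover have "?u n = 0" for n
      using False order_geD[OF G] by simp
    ultimately show ?thesis by simp
  qed
qed

lemma nth_monomial_mult_commutator:
  "fls_nth (monomial f i \<star> fls_const h) (i + 1) = f * of_int i * d h"
proof -
  have "fls_nth (monomial f i \<star> fls_const h) (i + 1) =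
      (\<Sum>n\<le>1. f * of_int (pdo_coeff i n) * (d ^^ n) (fls_nth (fls_const h) (i + 1 - i - int n)))"
    by (rule nth_monomial_mult[OF order_ge_const]) simp
  thus ?thesis
    using pdo_coeff_1[of i] by simp
qed

lemma mult_monomial: "F \<star> monomial 1 j = fls_shift (- j) F"
proof (rule continuous_additive_eqI[where \<phi> = "\<lambda>F. F \<star> monomial 1 j"])
  show "continuous_additive (fls_shift (- j) :: 'a fls \<Rightarrow> 'a fls)"
    by (rule continuous_additiveI[where c = j]) (auto simp: order_ge_def)
next
  fix f i
  show "monomial f i \<star> monomial 1 j = fls_shift (- j) (monomial f i)"
  proof (rule fls_eqI)
    fix k
    have "fls_nth (monomial f i \<star> monomial 1 j) k =
        (\<Sum>n\<le>nat (k - i - j). f * of_int (pdo_coeff i n)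
          * (d ^^ n) (fls_nth (monomial 1 j) (k - i - int n)))"
      by (rule nth_monomial_mult[OF order_ge_monomial]) simp
    also have "\<dots> = (\<Sum>n\<le>nat (k - i - j). if n = 0 then if k = i + j then f else 0 else 0)"
      by (intro sum.cong) (auto simp: dn_1 pdo_coeff_0)
    also have "\<dots> = fls_nth (fls_shift (- j) (monomial f i)) k"
      by auto
    finally show "fls_nth (monomial f i \<star> monomial 1 j) k = fls_nth (fls_shift (- j) (monomial f i)) k" .
  qed
qed (rule continuous_additive_mult_right)

lemma mult_1_right [simp]: "F \<star> 1 = F"
  using mult_monomial[of F 0] by (simp add: monomial_degree_0)

lemma mult_X_inv: "F \<star> fls_X_inv = fls_shift 1 F"
  using mult_monomial[of F "-1"] by (simp add: monomial_X_inv)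

lemma nth_X_inv_mult: "fls_nth (fls_X_inv \<star> G) k = fls_nth G (k + 1) - d (fls_nth G k)"
proof -
  \<comment> \<open>The successor makes the two summands with nonzero coefficient available.\<close>
  define N where "N = Suc (nat (k + 1 - fls_subdegree G))"
  have c: "pdo_coeff (-1) n = (if n = 0 then 1 else if n = 1 then -1 else 0)" for n
    by (auto simp: pdo_coeff_def binomial_eq_0)
  have "fls_nth (fls_X_inv \<star> G) k = (\<Sum>n\<le>Suc N. 1 * of_int (pdo_coeff (-1) n) *
      (d ^^ n) (fls_nth G (k - (-1) - int n)))"
    unfolding monomial_X_inv[symmetric]
    by (rule nth_monomial_mult[OF order_ge_subdegree]) (simp add: N_def)
  also have "\<dots> = fls_nth G (k + 1) - d (fls_nth G k)"
    unfolding sum.atMost_Suc_shift N_def by (simp add: c sum.atMost_Suc_shift del: sum.atMost_Suc)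
  finally show ?thesis .
qed

lemma X_inv_mult_monomial: "fls_X_inv \<star> monomial f i = monomial f (i - 1) - monomial (d f) i"
  by (rule fls_eqI) (auto simp: nth_X_inv_mult)

abbreviation degree_one where "degree_one p q \<equiv> fls_const p \<star> fls_X_inv + fls_const q"

lemma nth_degree_one_mult:
  "fls_nth (degree_one p q \<star> G) k = p * (fls_nth G (k + 1) - d (fls_nth G k)) + q * fls_nth G k"
  by (simp add: mult_add_left const_mult_assoc nth_X_inv_mult)

text \<open>The lowest coefficient of the product is \<open>p\<close> times the lowest coefficient of the right factor.\<close>

lemma degree_one_mult_inj:
  assumes unit: "p * p' = 1" and eq: "degree_one p q \<star> G = degree_one p q \<star> H"
  shows "G = H"
proof -
  define Z where "Z = G - H"
  have "fls_nth (degree_one p q \<star> Z) k = 0" for k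
    using eq by (simp add: Z_def mult_diff_right)
  hence zero: "p * (fls_nth Z (k + 1) - d (fls_nth Z k)) + q * fls_nth Z k = 0" for k
    by (simp only: nth_degree_one_mult)
  have rec: "fls_nth Z (k + 1) = 0" if "fls_nth Z k = 0" for k
  proof -
    have "p * fls_nth Z (k + 1) = 0"
      using zero[of k] that by simp
    hence "p' * (p * fls_nth Z (k + 1)) = 0"
      by simp
    moreover have "p' * (p * fls_nth Z (k + 1)) = (p * p') * fls_nth Z (k + 1)"
      by (simp only: ac_simps)
    ultimately show ?thesis
      using unit by simp
  qed
  have "fls_nth Z (fls_subdegree Z) = 0"
    using rec[of "fls_subdegree Z - 1"] by simp
  hence "Z = 0"
    by (simp add: nth_fls_subdegree_zero_iff)
  thus ?thesis by (simp add: Z_def)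
qed

lemma X_inv_mult_inj: "fls_X_inv \<star> G = fls_X_inv \<star> H \<Longrightarrow> G = H"
  using degree_one_mult_inj[of 1 1 0 G H] by simp

lemma X_inv_mult_X_power_mult: "fls_X_inv \<star> (monomial 1 i \<star> H) = monomial 1 (i - 1) \<star> H"
proof (rule fls_eqI)
  fix k
  let ?b = "fls_subdegree H"
  define N where "N = nat (k - i + 1 - ?b)"
  let ?e = "\<lambda>n. (d ^^ n) (fls_nth H (k + 1 - i - int n))"
  have 1: "fls_nth (monomial 1 (i - 1) \<star> H) k = (\<Sum>n\<le>Suc N. of_int (pdo_coeff (i - 1) n) * ?e n)"
    using nth_monomial_mult[OF order_ge_subdegree, of k "i - 1" H "Suc N" 1]
    by (simp add: N_def algebra_simps del: sum.atMost_Suc)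
  have 2: "fls_nth (monomial 1 i \<star> H) (k + 1) = (\<Sum>n\<le>Suc N. of_int (pdo_coeff i n) * ?e n)"
    using nth_monomial_mult[OF order_ge_subdegree, of "k + 1" i H "Suc N" 1]
    by (simp add: N_def algebra_simps del: sum.atMost_Suc)
  have "fls_nth (monomial 1 i \<star> H) k =
      (\<Sum>n\<le>N. of_int (pdo_coeff i n) * (d ^^ n) (fls_nth H (k - i - int n)))"
    using nth_monomial_mult[OF order_ge_subdegree, of k i H N 1] by (simp add: N_def)
  hence 3: "d (fls_nth (monomial 1 i \<star> H) k) = (\<Sum>n\<le>N. of_int (pdo_coeff i n) * ?e (Suc n))"
    by (simp add: d_sum d_of_int_mult algebra_simps)
  have "fls_nth (fls_X_inv \<star> (monomial 1 i \<star> H)) k =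
      ?e 0 + (\<Sum>n\<le>N. of_int (pdo_coeff i (Suc n) - pdo_coeff i n) * ?e (Suc n))"
    unfolding nth_X_inv_mult 2 3 sum.atMost_Suc_shift pdo_coeff_0
    by (simp add: sum_subtractf left_diff_distrib del: funpow.simps)
  also have "\<dots> = fls_nth (monomial 1 (i - 1) \<star> H) k"
    unfolding 1 sum.atMost_Suc_shift pdo_coeff_Pascal pdo_coeff_0 by simp
  finally show "fls_nth (fls_X_inv \<star> (monomial 1 i \<star> H)) k = fls_nth (monomial 1 (i - 1) \<star> H) k" .
qed

text \<open>
  By continuity \<open>G\<close> may be taken to be a monomial \<open>g x\<^sup>i\<close>. Then \<open>x\<^sup>-\<^sup>1\<close> can be moved past \<open>g\<close> on both sides,
  and what remains is \<open>x\<^sup>-\<^sup>1 (x\<^sup>i H) = x\<^sup>i\<^sup>-\<^sup>1 H\<close>.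
\<close>

lemma X_inv_mult_assoc: "(fls_X_inv \<star> G) \<star> H = fls_X_inv \<star> (G \<star> H)"
proof (rule continuous_additive_eqI[where F = G])
  show "continuous_additive (\<lambda>G. (fls_X_inv \<star> G) \<star> H)"
    by (rule continuous_additive_compose[OF continuous_additive_mult_right continuous_additive_mult_left])
  show "continuous_additive (\<lambda>G. fls_X_inv \<star> (G \<star> H))"
    by (rule continuous_additive_compose[OF continuous_additive_mult_left continuous_additive_mult_right])
next
  fix g i
  have X_inv_const: "fls_X_inv \<star> (fls_const g \<star> K) =
      fls_const g \<star> (fls_X_inv \<star> K) - fls_const (d g) \<star> K" for K
    by (rule fls_eqI) (simp add: nth_X_inv_mult d_mult algebra_simps)
  have split: "monomial f j \<star> H = fls_const f \<star> (monomial 1 j \<star> H)" for f j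
    by (subst monomial_eq_const_mult) (rule const_mult_assoc)
  show "(fls_X_inv \<star> monomial g i) \<star> H = fls_X_inv \<star> (monomial g i \<star> H)"
    unfolding X_inv_mult_monomial mult_diff_left split[of g] split[of "d g"] X_inv_const
      X_inv_mult_X_power_mult ..
qed

lemma X_power_mult_assoc: "(monomial 1 i \<star> G) \<star> H = monomial 1 i \<star> (G \<star> H)"
proof (induction i rule: int_induct[where k = 0])
  case base
  show ?case by (simp add: monomial_degree_0)
next
  case (step1 i)
  have "fls_X_inv \<star> ((monomial 1 (i + 1) \<star> G) \<star> H) = (monomial 1 i \<star> G) \<star> H"
    by (metis X_inv_mult_X_power_mult X_inv_mult_assoc add_diff_cancel_right')
  also have "\<dots> = fls_X_inv \<star> (monomial 1 (i + 1) \<star> (G \<star> H))"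
    by (simp add: X_inv_mult_X_power_mult step1)
  finally show ?case
    by (rule X_inv_mult_inj)
next
  case (step2 i)
  thus ?case
    by (metis X_inv_mult_X_power_mult X_inv_mult_assoc)
qed

text \<open>
  The elements \<open>F\<close> with \<open>(F G) H = F (G H)\<close> for all \<open>G\<close>, \<open>H\<close> include the constants and the powers of
  \<open>x\<close>, hence the monomials, and both sides are continuous in \<open>F\<close>.
\<close>

lemma mult_assoc: "(F \<star> G) \<star> H = F \<star> (G \<star> H)"
proof (rule continuous_additive_eqI[where F = F])
  show "continuous_additive (\<lambda>F. (F \<star> G) \<star> H)"
    by (rule continuous_additive_compose[OF continuous_additive_mult_right continuous_additive_mult_right])
  show "continuous_additive (\<lambda>F. F \<star> (G \<star> H))"
    by (rule continuous_additive_mult_right)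
  show "(monomial f i \<star> G) \<star> H = monomial f i \<star> (G \<star> H)" for f i
    by (simp add: monomial_eq_const_mult[of f i] const_mult_assoc X_power_mult_assoc)
qed

section \<open>Extending ring endomorphisms from the constants\<close>

lemma nth_degree_one:
  "fls_nth (degree_one p q) k = (if k = -1 then p else if k = 0 then q else 0)"
  by simp

lemma degree_one_order_ge: "degree_one p q \<in> order_ge (-1)"
  by (rule order_geI) (auto simp: nth_degree_one)

text \<open>
  Comparing coefficients in \<open>(p x\<^sup>-\<^sup>1 + q) W = E\<close> gives a recursion for the coefficients of \<open>W\<close>,
  which is solvable because \<open>p\<close> is a unit.
\<close>

lemma degree_one_mult_surj:
  assumes unit: "p * p' = 1" and E: "E \<in> order_ge a"
  shows "\<exists>W\<in>order_ge (a + 1). degree_one p q \<star> W = E"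
proof -
  define T where "T W = W - fls_shift (-1) (fls_X_inv \<star> W - fls_const p' \<star> (E - fls_const q \<star> W))"
    for W
  have nth_T: "fls_nth (T W) k =
      d (fls_nth W (k - 1)) + p' * (fls_nth E (k - 1) - q * fls_nth W (k - 1))" for W k
    by (simp add: T_def nth_X_inv_mult)
  have "\<exists>W\<in>order_ge (a + 1). T W = W"
  proof (rule contraction_fixpoint)
    fix W :: "'a fls" assume "W \<in> order_ge (a + 1)"
    thus "T W \<in> order_ge (a + 1)"
      using order_geD[OF E] by (intro order_geI) (simp add: nth_T order_geD)
  next
    fix W W' :: "'a fls" and k assume "W - W' \<in> order_ge k"
    hence "fls_nth W i = fls_nth W' i" if "i < k" for i
      using order_geD[of "W - W'" k i] that by simp
    thus "T W - T W' \<in> order_ge (k + 1)"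
      by (intro order_geI) (simp add: nth_T)
  qed
  then obtain W where W: "W \<in> order_ge (a + 1)" "T W = W" by blast
  have "degree_one p q \<star> W = E"
  proof (rule fls_eqI)
    fix k
    have "fls_nth W (k + 1) = d (fls_nth W k) + p' * (fls_nth E k - q * fls_nth W k)"
      using nth_T[of W "k + 1"] W(2) by simp
    hence "fls_nth (degree_one p q \<star> W) k =
        (p * p') * (fls_nth E k - q * fls_nth W k) + q * fls_nth W k"
      unfolding nth_degree_one_mult by (simp add: mult.assoc)
    thus "fls_nth (degree_one p q \<star> W) k = fls_nth E k"
      using unit by simp
  qed
  with W(1) show ?thesis by blast
qed

text \<open>
  \<open>W i\<close> is the power of exponent \<open>-i\<close> of \<open>p x\<^sup>-\<^sup>1 + q\<close>, so that it replaces \<open>x\<^sup>i\<close>.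
\<close>

lemma degree_one_powers:
  assumes unit: "p * p' = 1"
  obtains W where "W 0 = 1" "\<And>i. degree_one p q \<star> W i = W (i - 1)" "\<And>i. W i \<in> order_ge i"
proof -
  let ?y = "degree_one p q"
  obtain w where w: "w \<in> order_ge 1" "?y \<star> w = 1"
    using degree_one_mult_surj[OF unit order_ge_1] by auto
  define W where "W i = (if i \<ge> 0 then ((\<star>) w ^^ nat i) 1 else ((\<star>) ?y ^^ nat (- i)) 1)" for i :: int
  have pos: "W (int (Suc n)) = w \<star> W (int n)" for n
    by (simp add: W_def nat_add_distrib del: of_nat_Suc)
  have neg: "W (- int (Suc n)) = ?y \<star> W (- int n)" for n
    by (cases "n = 0") (simp_all add: W_def nat_add_distrib del: of_nat_Suc)
  show ?thesis
  proof (rule that[of W])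
    show W0: "W 0 = 1" by (simp add: W_def)
    show "?y \<star> W i = W (i - 1)" for i
    proof (cases "i > 0")
      case True
      then obtain n where n: "i = int (Suc n)"
        by (metis gr0_implies_Suc zero_less_imp_eq_int)
      have "?y \<star> W i = (?y \<star> w) \<star> W (int n)"
        unfolding n pos by (rule mult_assoc[symmetric])
      thus ?thesis using w(2) by (simp add: n)
    next
      case False
      then obtain n where n: "i = - int n"
        by (metis nonpos_int_cases not_less)
      hence "i - 1 = - int (Suc n)" by simp
      thus ?thesis
        using neg[of n] by (simp only: n)
    qed
    show "W i \<in> order_ge i" for i
    proof (cases i rule: int_cases2)
      case (nonneg n)
      have "W (int n) \<in> order_ge (int n)"
      proof (induction n)
        case 0
        thus ?case using W0 order_ge_1 by simp
      next
        case (Suc n)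
        show ?case
          unfolding pos using mult_order_ge[OF w(1) Suc] by simp
      qed
      thus ?thesis using nonneg by simp
    next
      case (nonpos n)
      have "W (- int n) \<in> order_ge (- int n)"
      proof (induction n)
        case 0
        thus ?case using W0 order_ge_1 by simp
      next
        case (Suc n)
        have "?y \<star> W (- int n) \<in> order_ge (- 1 + - int n)"
          by (rule mult_order_ge[OF degree_one_order_ge Suc])
        thus ?case unfolding neg by simp
      qed
      thus ?thesis using nonpos by simp
    qed
  qed
qed

definition pdo_hom :: "('a fls \<Rightarrow> 'a fls) \<Rightarrow> bool" where
  "pdo_hom \<phi> \<longleftrightarrow>
     \<phi> 1 = 1 \<and> (\<forall>F G. \<phi> (F + G) = \<phi> F + \<phi> G) \<and> (\<forall>F G. \<phi> (F \<star> G) = \<phi> F \<star> \<phi> G)"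

lemma
  assumes "pdo_hom \<phi>"
  shows pdo_hom_1: "\<phi> 1 = 1" and pdo_hom_add: "\<phi> (F + G) = \<phi> F + \<phi> G"
    and pdo_hom_mult: "\<phi> (F \<star> G) = \<phi> F \<star> \<phi> G"
  using assms by (auto simp: pdo_hom_def)

lemma pdo_hom_compose: "pdo_hom \<phi> \<Longrightarrow> pdo_hom \<psi> \<Longrightarrow> pdo_hom (\<lambda>F. \<phi> (\<psi> F))"
  by (simp add: pdo_hom_def)

text \<open>
  With \<open>w\<close> the inverse of \<open>p x\<^sup>-\<^sup>1 + q\<close>, the extension is \<open>\<sigma> (\<Sum>i f\<^sub>i x\<^sup>i) = \<Sum>i g(f\<^sub>i) w\<^sup>i\<close>. The condition on
  \<open>g\<close> says that \<open>p x\<^sup>-\<^sup>1 + q\<close> satisfies the commutation rule required of the image of \<open>x\<^sup>-\<^sup>1\<close>, so that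
  \<open>\<sigma> (x\<^sup>-\<^sup>1 G) = \<sigma> (x\<^sup>-\<^sup>1) \<sigma> (G)\<close>. The elements \<open>F\<close> with \<open>\<sigma> (F G) = \<sigma> (F) \<sigma> (G)\<close> for all \<open>G\<close> then
  include the powers of \<open>x\<close> and the monomials, and by continuity everything; the expansion of
  \<open>w\<^sup>i f\<close> is never computed.
\<close>

lemma extension_exists:
  assumes g_add: "\<And>f h. g (f + h) = g f + g h" and g_mult: "\<And>f h. g (f * h) = g f * g h"
    and g_1: "g 1 = 1" and g_d: "\<And>f. g (d f) = p * d (g f)" and unit: "p * p' = 1"
  shows "\<exists>\<sigma>. pdo_hom \<sigma> \<and> continuous_additive \<sigma> \<and> (\<forall>f. \<sigma> (fls_const f) = fls_const (g f)) \<and>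
    \<sigma> fls_X_inv = degree_one p q"
proof -
  obtain W where W_0: "W 0 = 1" and W_pred: "\<And>i. degree_one p q \<star> W i = W (i - 1)"
    and W_ge: "\<And>i. W i \<in> order_ge i"
    using degree_one_powers[OF unit] by blast
  have g_0 [simp]: "g 0 = 0"
    by (rule additive_zero[of g]) (rule g_add)
  define \<sigma> where "\<sigma> F = Abs_fls (\<lambda>k. \<Sum>i | fls_nth F i \<noteq> 0 \<and> i \<le> k. g (fls_nth F i) * fls_nth (W i) k)"
    for F
  have nth_\<sigma>: "fls_nth (\<sigma> F) k = (\<Sum>i\<in>{a..k}. g (fls_nth F i) * fls_nth (W i) k)"
    if F: "F \<in> order_ge a" for F a k
  proof -
    have "fls_nth (\<sigma> F) k = (\<Sum>i | fls_nth F i \<noteq> 0 \<and> i \<le> k. g (fls_nth F i) * fls_nth (W i) k)"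
      unfolding \<sigma>_def
    proof (rule nth_Abs_fls_lower_bound[of a], intro allI impI)
      fix k assume "k < a"
      hence "{i. fls_nth F i \<noteq> 0 \<and> i \<le> k} = {}"
        using order_geD[OF F] by force
      thus "(\<Sum>i | fls_nth F i \<noteq> 0 \<and> i \<le> k. g (fls_nth F i) * fls_nth (W i) k) = 0"
        by (simp only: sum.empty)
    qed
    also have "\<dots> = (\<Sum>i\<in>{a..k}. g (fls_nth F i) * fls_nth (W i) k)"
      by (rule sum.mono_neutral_left) (use order_geD[OF F] in \<open>force+\<close>)
    finally show ?thesis .
  qed
  have \<sigma>_add: "\<sigma> (F + G) = \<sigma> F + \<sigma> G" for F G
  proof (rule fls_eqI)
    fix k
    obtain a where a: "F \<in> order_ge a" "G \<in> order_ge a"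
      by (rule order_ge_common)
    show "fls_nth (\<sigma> (F + G)) k = fls_nth (\<sigma> F + \<sigma> G) k"
      by (simp add: nth_\<sigma>[OF a(1)] nth_\<sigma>[OF a(2)] nth_\<sigma>[OF order_ge_add[OF a]] g_add
          sum.distrib algebra_simps)
  qed
  have cont: "continuous_additive \<sigma>"
    by (rule continuous_additiveI[where c = 0]) (auto simp: \<sigma>_add nth_\<sigma> intro!: order_geI)
  have \<sigma>_monomial: "\<sigma> (monomial f i) = fls_const (g f) \<star> W i" for f i
  proof (rule fls_eqI)
    fix k
    have "fls_nth (\<sigma> (monomial f i)) k = (\<Sum>j\<in>{i..k}. if j = i then g f * fls_nth (W i) k else 0)"
      unfolding nth_\<sigma>[OF order_ge_monomial] by (intro sum.cong) auto
    thus "fls_nth (\<sigma> (monomial f i)) k = fls_nth (fls_const (g f) \<star> W i) k"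
      using order_geD[OF W_ge, of k i] by simp
  qed
  have \<sigma>_const: "\<sigma> (fls_const f) = fls_const (g f)" for f
    using \<sigma>_monomial[of f 0] by (simp add: monomial_degree_0 W_0)
  have \<sigma>_X_inv: "\<sigma> fls_X_inv = degree_one p q"
    using \<sigma>_monomial[of 1 "-1"] W_pred[of 0] by (simp add: monomial_X_inv W_0 g_1)
  have \<sigma>_const_mult: "\<sigma> (fls_const f \<star> G) = fls_const (g f) \<star> \<sigma> G" for f G
  proof (rule fls_eqI)
    fix k
    have "fls_const f \<star> G \<in> order_ge (fls_subdegree G)"
      using mult_order_ge[OF order_ge_const order_ge_subdegree] by simp
    thus "fls_nth (\<sigma> (fls_const f \<star> G)) k = fls_nth (fls_const (g f) \<star> \<sigma> G) k"
      by (simp add: nth_\<sigma>[of _ "fls_subdegree G"] order_ge_subdegree g_mult sum_distrib_left mult.assoc)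
  qed
  have commute: "degree_one p q \<star> (fls_const (g f) \<star> K) =
      fls_const (g f) \<star> (degree_one p q \<star> K) - fls_const (g (d f)) \<star> K" for f K
    by (rule fls_eqI, unfold fls_minus_nth nth_const_mult nth_degree_one_mult)
      (simp add: d_mult g_d algebra_simps)
  have \<sigma>_diff: "\<sigma> (F - G) = \<sigma> F - \<sigma> G" for F G
    by (rule additive_diff) (rule \<sigma>_add)
  have \<sigma>_X_inv_mult: "\<sigma> (fls_X_inv \<star> G) = degree_one p q \<star> \<sigma> G" for G
  proof (rule continuous_additive_eqI[where F = G])
    show "\<sigma> (fls_X_inv \<star> monomial f i) = degree_one p q \<star> \<sigma> (monomial f i)" for f i
      by (simp only: X_inv_mult_monomial \<sigma>_diff \<sigma>_monomial commute W_pred)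
  qed (intro continuous_additive_compose[OF cont] continuous_additive_compose[OF _ cont]
      continuous_additive_mult_left)+
  have \<sigma>_X_power_mult: "\<sigma> (monomial 1 i \<star> G) = W i \<star> \<sigma> G" for i G
  proof (induction i rule: int_induct[where k = 0])
    case base
    show ?case by (simp add: monomial_degree_0 W_0)
  next
    case (step1 i)
    have "degree_one p q \<star> \<sigma> (monomial 1 (i + 1) \<star> G) = W i \<star> \<sigma> G"
      by (simp add: X_inv_mult_X_power_mult step1 flip: \<sigma>_X_inv_mult)
    also have "\<dots> = degree_one p q \<star> (W (i + 1) \<star> \<sigma> G)"
      by (simp add: W_pred flip: mult_assoc)
    finally show ?case
      by (rule degree_one_mult_inj[OF unit])
  next
    case (step2 i)
    have "\<sigma> (monomial 1 (i - 1) \<star> G) = degree_one p q \<star> (W i \<star> \<sigma> G)"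
      by (simp only: \<sigma>_X_inv_mult step2 flip: X_inv_mult_X_power_mult)
    thus ?case
      by (simp add: W_pred flip: mult_assoc)
  qed
  have \<sigma>_mult: "\<sigma> (F \<star> G) = \<sigma> F \<star> \<sigma> G" for F G
  proof (rule continuous_additive_eqI[where F = F])
    show "\<sigma> (monomial f i \<star> G) = \<sigma> (monomial f i) \<star> \<sigma> G" for f i
      unfolding \<sigma>_monomial
      by (subst monomial_eq_const_mult) (simp only: mult_assoc \<sigma>_const_mult \<sigma>_X_power_mult)
  qed (intro continuous_additive_compose[OF cont] continuous_additive_compose[OF _ cont]
      continuous_additive_mult_right)+
  have "pdo_hom \<sigma>"
    using \<sigma>_add \<sigma>_mult \<sigma>_const[of 1] by (simp add: pdo_hom_def g_1)
  with cont \<sigma>_const \<sigma>_X_inv show ?thesis by blast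
qed

text \<open>
  The values on the powers of \<open>x\<close> agree because the image of \<open>x\<close> is the inverse of the image of \<open>x\<^sup>-\<^sup>1\<close>.
\<close>

lemma continuous_hom_eqI:
  assumes \<phi>: "pdo_hom \<phi>" "continuous_additive \<phi>" and \<psi>: "pdo_hom \<psi>" "continuous_additive \<psi>"
    and const: "\<And>f. \<phi> (fls_const f) = \<psi> (fls_const f)" and X_inv: "\<phi> fls_X_inv = \<psi> fls_X_inv"
  shows "\<phi> = \<psi>"
proof
  fix F
  have power: "\<phi> (monomial 1 i) = \<psi> (monomial 1 i)" for i
  proof (induction i rule: int_induct[where k = 0])
    case base
    show ?case using const[of 1] by (simp add: monomial_degree_0)
  next
    case (step1 i)
    have pred: "fls_X_inv \<star> monomial 1 (i + 1) = monomial 1 i"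
      using X_inv_mult_monomial[of 1 "i + 1"] by (simp add: monomial_def)
    have "\<phi> fls_X_inv \<star> \<phi> (monomial 1 (i + 1)) = \<phi> fls_X_inv \<star> \<psi> (monomial 1 (i + 1))"
      using step1 \<phi>(1) \<psi>(1) by (metis X_inv pdo_hom_mult pred)
    hence "(\<phi> fls_X \<star> \<phi> fls_X_inv) \<star> \<phi> (monomial 1 (i + 1)) =
        (\<phi> fls_X \<star> \<phi> fls_X_inv) \<star> \<psi> (monomial 1 (i + 1))"
      by (simp only: mult_assoc)
    moreover have "\<phi> fls_X \<star> \<phi> fls_X_inv = 1"
      using \<phi>(1) by (simp add: pdo_hom_1 pdo_mult_X_X_inv[OF deriv] flip: pdo_hom_mult[OF \<phi>(1)])
    ultimately show ?case by simp
  next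
    case (step2 i)
    have "fls_X_inv \<star> monomial 1 i = monomial 1 (i - 1)"
      using X_inv_mult_monomial[of 1 i] by (simp add: monomial_def)
    with step2 \<phi>(1) \<psi>(1) X_inv show ?case
      by (metis pdo_hom_mult)
  qed
  show "\<phi> F = \<psi> F"
  proof (rule continuous_additive_eqI[OF \<phi>(2) \<psi>(2)])
    show "\<phi> (monomial f i) = \<psi> (monomial f i)" for f i
      unfolding monomial_eq_const_mult[of f i] by (simp only: pdo_hom_mult \<phi>(1) \<psi>(1) power const)
  qed
qed

lemma pdo_hom_preserves_polynomials:
  assumes hom: "pdo_hom \<sigma>" and const: "\<And>f. \<sigma> (fls_const f) = fls_const (g f)"
    and X_inv: "\<sigma> fls_X_inv = degree_one p q" and F: "\<And>i. i > 0 \<Longrightarrow> fls_nth F i = 0"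
    and k: "k > 0"
  shows "fls_nth (\<sigma> F) k = 0"
proof -
  have power: "\<forall>k>0. fls_nth (\<sigma> (monomial 1 (- int n))) k = 0" for n
  proof (induction n)
    case 0
    show ?case by (simp add: monomial_degree_0 pdo_hom_1[OF hom])
  next
    case (Suc n)
    have "monomial 1 (- int (Suc n)) = fls_X_inv \<star> monomial 1 (- int n)"
      using X_inv_mult_monomial[of 1 "- int n"] by (simp add: monomial_def algebra_simps)
    hence "\<sigma> (monomial 1 (- int (Suc n))) = degree_one p q \<star> \<sigma> (monomial 1 (- int n))"
      by (simp only: pdo_hom_mult[OF hom] X_inv)
    thus ?case
      using Suc by (simp only: nth_degree_one_mult) simp
  qed
  have monomial: "fls_nth (\<sigma> (monomial f i)) k = 0" if i: "i \<le> 0" for f i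
  proof -
    from i obtain n where "i = - int n"
      by (rule nonpos_int_cases)
    thus ?thesis
      unfolding monomial_eq_const_mult[of f i] pdo_hom_mult[OF hom] const
      using power k by simp
  qed
  have "\<sigma> F = \<sigma> (\<Sum>i\<in>{fls_subdegree F..0}. monomial (fls_nth F i) i)"
    by (rule arg_cong[OF monomial_expansion[OF order_ge_subdegree F]])
  also have "\<dots> = (\<Sum>i\<in>{fls_subdegree F..0}. \<sigma> (monomial (fls_nth F i) i))"
    by (rule additive_sum) (rule pdo_hom_add[OF hom])
  finally show ?thesis
    using monomial by (simp add: nth_sum_fls)
qed

end
section \<open>Automatic continuity over a domain\<close>

locale differential_domain = differential_ring d
  for d :: "'a::{idom, ring_char_0} \<Rightarrow> 'a" +
  assumes nonzero: "\<exists>f. d f \<noteq> 0"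
begin

lemma nth_mult_lowest:
  assumes "F \<in> order_ge a" "G \<in> order_ge b"
  shows "fls_nth (F \<star> G) (a + b) = fls_nth F a * fls_nth G b"
  by (simp add: nth_mult_box[OF assms] pdo_coeff_0)

lemma subdegree_square: "fls_subdegree (F \<star> F) = 2 * fls_subdegree F"
proof (cases "F = 0")
  case False
  let ?m = "fls_subdegree F"
  show ?thesis
  proof (rule fls_subdegree_eqI)
    show "fls_nth (F \<star> F) (2 * ?m) \<noteq> 0"
      using nth_mult_lowest[OF order_ge_subdegree order_ge_subdegree, of F F] False by simp
    show "fls_nth (F \<star> F) k = 0" if "k < 2 * ?m" for k
      using order_geD[OF mult_order_ge[OF order_ge_subdegree order_ge_subdegree], of k F F] that
      by simp
  qed
qed simp

text \<open>A solution of \<open>2 H = F - H\<^sup>2\<close> is found by iteration, since squaring raises the order.\<close>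

lemma square_root_exists:
  assumes half: "c + c = (1::'a)" and F: "F \<in> order_ge 1"
  shows "\<exists>H\<in>order_ge 1. (1 + H) \<star> (1 + H) = 1 + F"
proof -
  define T where "T H = fls_const c \<star> (F - H \<star> H)" for H
  have const_mult_ge: "fls_const c \<star> K \<in> order_ge k" if "K \<in> order_ge k" for K k
    using mult_order_ge[OF order_ge_const that] by simp
  have "\<exists>H\<in>order_ge 1. T H = H"
  proof (rule contraction_fixpoint)
    fix H :: "'a fls" assume "H \<in> order_ge 1"
    from mult_order_ge[OF this this] have "H \<star> H \<in> order_ge 1"
      by (rule order_ge_antimono) simp
    thus "T H \<in> order_ge 1"
      unfolding T_def by (intro const_mult_ge order_ge_minus F)
  next
    fix H H' :: "'a fls" and k
    assume H: "H \<in> order_ge 1" "H' \<in> order_ge 1" "H - H' \<in> order_ge k"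
    have "T H - T H' = fls_const c \<star> (0 - (H \<star> (H - H') + (H - H') \<star> H'))"
      by (simp add: T_def mult_diff_right mult_diff_left mult_add_right)
    moreover have "H \<star> (H - H') \<in> order_ge (k + 1)" "(H - H') \<star> H' \<in> order_ge (k + 1)"
      using mult_order_ge[OF H(1,3)] mult_order_ge[OF H(3,2)] by (simp_all add: add.commute)
    ultimately show "T H - T H' \<in> order_ge (k + 1)"
      by (simp only:) (intro const_mult_ge order_ge_minus order_ge_add order_ge_0)
  qed
  then obtain H where H: "H \<in> order_ge 1" "T H = H" by blast
  have "H + H = F - H \<star> H"
  proof (rule fls_eqI)
    fix k
    have "fls_nth H k = c * fls_nth (F - H \<star> H) k"
      using H(2) by (metis T_def nth_const_mult)
    hence "fls_nth (H + H) k = (c + c) * fls_nth (F - H \<star> H) k"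
      by (simp add: distrib_right)
    thus "fls_nth (H + H) k = fls_nth (F - H \<star> H) k"
      using half by simp
  qed
  moreover have "(1 + H) \<star> (1 + H) = 1 + (H + H + H \<star> H)"
    by (simp add: mult_add_left mult_add_right ac_simps)
  ultimately have "(1 + H) \<star> (1 + H) = 1 + F"
    by simp
  with H(1) show ?thesis by blast
qed

text \<open>
  No continuity is assumed of \<open>\<tau>\<close>. For \<open>F\<close> of positive order, \<open>1 + F\<close> is a square of an element of
  the same kind, so the order of \<open>\<tau> (1 + F)\<close> can be halved indefinitely and must be zero. Hence
  \<open>\<tau> F\<close> has order at least \<open>0\<close>, and continuity follows by dividing by powers of \<open>x\<close>.
\<close>

lemma pdo_hom_continuous:
  assumes half: "c + c = (1::'a)" and hom: "pdo_hom \<tau>"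
    and X_inv: "\<tau> fls_X_inv = degree_one p q" and unit: "p * p' = 1"
  shows "continuous_additive \<tau>"
proof -
  have subdegree_0: "fls_subdegree (\<tau> (1 + F)) = 0" if "F \<in> order_ge 1" for F
    using that
  proof (induction "nat \<bar>fls_subdegree (\<tau> (1 + F))\<bar>" arbitrary: F rule: less_induct)
    case less
    obtain H where H: "H \<in> order_ge 1" "(1 + H) \<star> (1 + H) = 1 + F"
      using square_root_exists[OF half less.prems] by blast
    have eq: "fls_subdegree (\<tau> (1 + F)) = 2 * fls_subdegree (\<tau> (1 + H))"
      unfolding H(2)[symmetric] pdo_hom_mult[OF hom] by (rule subdegree_square)
    show ?case
    proof (rule ccontr)
      assume "fls_subdegree (\<tau> (1 + F)) \<noteq> 0"
      with eq have "nat \<bar>fls_subdegree (\<tau> (1 + H))\<bar> < nat \<bar>fls_subdegree (\<tau> (1 + F))\<bar>"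
        by simp
      from less.hyps[OF this H(1)] eq \<open>fls_subdegree (\<tau> (1 + F)) \<noteq> 0\<close> show False
        by simp
    qed
  qed
  have nonneg: "\<tau> F \<in> order_ge 0" if "F \<in> order_ge 1" for F
  proof -
    have "\<tau> (1 + F) \<in> order_ge 0"
      using order_ge_subdegree[of "\<tau> (1 + F)"] subdegree_0[OF that] by simp
    hence "\<tau> (1 + F) - 1 \<in> order_ge 0"
      by (intro order_ge_minus order_ge_1)
    thus ?thesis by (simp add: pdo_hom_add[OF hom] pdo_hom_1[OF hom])
  qed
  obtain w where w: "w \<in> order_ge 1" "degree_one p q \<star> w = 1"
    using degree_one_mult_surj[OF unit order_ge_1] by auto
  have shift: "\<tau> F \<in> order_ge (int n)" if "F \<in> order_ge (1 + int n)" for F n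
    using that
  proof (induction n arbitrary: F)
    case 0
    thus ?case using nonneg by simp
  next
    case (Suc n)
    have "F \<star> fls_X_inv \<in> order_ge (1 + int n)"
      using Suc.prems by (auto simp: mult_X_inv order_ge_def)
    from Suc.IH[OF this] have "\<tau> F \<star> degree_one p q \<in> order_ge (int n)"
      by (simp only: pdo_hom_mult[OF hom] X_inv)
    from mult_order_ge[OF this w(1)] show ?case
      unfolding mult_assoc w(2) by (simp add: add.commute)
  qed
  show ?thesis
    unfolding continuous_additive_def
  proof (intro conjI allI)
    fix M
    have "\<tau> F \<in> order_ge M" if "F \<in> order_ge (1 + int (nat M))" for F
      by (rule order_ge_antimono[OF shift[OF that]]) simp
    thus "\<exists>N. \<forall>F\<in>order_ge N. \<tau> F \<in> order_ge M" by blast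
  qed (rule pdo_hom_add[OF hom])
qed

section \<open>Operators whose commutators with constants are constant\<close>

lemma degree_one_commutator:
  "degree_one p q \<star> fls_const h - fls_const h \<star> degree_one p q = fls_const (- (p * d h))"
  by (rule fls_eqI, unfold fls_minus_nth nth_degree_one_mult nth_const_mult)
    (auto simp: algebra_simps)

lemma commutator_next_to_lowest:
  assumes Z: "Z \<in> order_ge m"
  shows "fls_nth (Z \<star> fls_const h - fls_const h \<star> Z) (m + 1) = of_int m * fls_nth Z m * d h"
proof -
  define Y where "Y = Z - monomial (fls_nth Z m) m"
  have Y: "Y \<in> order_ge (m + 1)"
    by (rule order_geI) (use order_geD[OF Z] in \<open>auto simp: Y_def\<close>)
  have "Z = monomial (fls_nth Z m) m + Y"
    by (simp add: Y_def)
  hence "fls_nth (Z \<star> fls_const h) (m + 1) =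
      fls_nth (monomial (fls_nth Z m) m \<star> fls_const h) (m + 1) + fls_nth (Y \<star> fls_const h) (m + 1)"
    by (metis mult_add_left fls_plus_nth)
  also have "fls_nth (Y \<star> fls_const h) (m + 1) = fls_nth Z (m + 1) * h"
    using nth_mult_lowest[OF Y order_ge_const] by (simp add: Y_def)
  finally show ?thesis
    unfolding fls_minus_nth nth_const_mult nth_monomial_mult_commutator by (simp add: algebra_simps)
qed

text \<open>
  If \<open>z x\<^sup>m\<close> is the lowest term of \<open>Z\<close>, the commutator of \<open>Z\<close> with \<open>h\<close> starts with
  \<open>m z d(h) x\<^sup>m\<^sup>+\<^sup>1\<close>. For this to be constant for every \<open>h\<close>, either \<open>m = 0\<close> or \<open>m = -1\<close>.
\<close>

lemma degree_one_if_constant_commutators: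
  assumes const: "\<And>h. \<exists>c. Y \<star> fls_const h - fls_const h \<star> Y = fls_const c"
  shows "Y = degree_one (fls_nth Y (-1)) (fls_nth Y 0)"
proof -
  obtain h where h: "d h \<noteq> 0"
    using nonzero by blast
  have lowest: "fls_subdegree Z \<in> {-1, 0}"
    if Z: "\<And>h. \<exists>c. Z \<star> fls_const h - fls_const h \<star> Z = fls_const c" for Z
  proof (cases "Z = 0")
    case False
    let ?m = "fls_subdegree Z"
    show ?thesis
    proof (cases "?m = -1")
      case neq: False
      obtain c where "Z \<star> fls_const h - fls_const h \<star> Z = fls_const c"
        using Z by blast
      with commutator_next_to_lowest[OF order_ge_subdegree, of Z h] neq
      have "of_int ?m * fls_nth Z ?m * d h = 0"
        by (simp del: fls_minus_nth)
      with False h show ?thesis by simp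
    qed simp
  qed simp
  \<comment> \<open>Removing the terms of degree \<open>-1\<close> and \<open>0\<close> keeps the hypothesis and leaves no possible lowest term.\<close>
  define L where "L = degree_one (fls_nth Y (-1)) (fls_nth Y 0)"
  define Z where "Z = Y - L"
  have "\<exists>c. Z \<star> fls_const h - fls_const h \<star> Z = fls_const c" for h
  proof -
    obtain c where c: "Y \<star> fls_const h - fls_const h \<star> Y = fls_const c"
      using const by blast
    obtain c' where c': "L \<star> fls_const h - fls_const h \<star> L = fls_const c'"
      unfolding L_def using degree_one_commutator by blast
    have "Z \<star> fls_const h - fls_const h \<star> Z =
        (Y \<star> fls_const h - fls_const h \<star> Y) - (L \<star> fls_const h - fls_const h \<star> L)"
      by (simp add: Z_def mult_diff_left mult_diff_right)
    thus ?thesis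
      unfolding c c' by (metis fls_minus_const)
  qed
  hence "fls_subdegree Z \<in> {-1, 0}"
    by (rule lowest)
  moreover have "fls_nth Z (-1) = 0" "fls_nth Z 0 = 0"
    by (simp_all add: Z_def L_def)
  ultimately have "Z = 0"
    by (metis nth_fls_subdegree_zero_iff insertE singletonD)
  thus ?thesis
    by (simp add: Z_def L_def)
qed

end

section \<open>Extending group actions\<close>

lemma unit_group_iff: "u \<in> unit_group \<longleftrightarrow> (\<exists>v. u * v = 1)"
  by (auto simp: Units_def ring_of_type_algebra_def mult.commute)

lemma unit_group_inv: "u \<in> unit_group \<Longrightarrow> u * inv\<^bsub>ring_of_type_algebra\<^esub> u = 1"
  using monoid.Units_r_inv[OF ring.is_monoid[OF ring_from_type_algebra], of u]
  by (simp add: ring_of_type_algebra_def)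

lemma pdo_ring_simps:
  "carrier (pdo_ring d) = UNIV" "a \<otimes>\<^bsub>pdo_ring d\<^esub> b = pdo_mult d a b"
  "a \<oplus>\<^bsub>pdo_ring d\<^esub> b = a + b" "\<one>\<^bsub>pdo_ring d\<^esub> = 1"
  by (simp_all add: pdo_ring_def)

lemma do_ring_simps:
  "carrier (do_ring d) = {F. \<forall>i>0. fls_nth F i = 0}" "a \<otimes>\<^bsub>do_ring d\<^esub> b = pdo_mult d a b"
  "a \<oplus>\<^bsub>do_ring d\<^esub> b = a + b" "\<one>\<^bsub>do_ring d\<^esub> = 1"
  by (simp_all add: do_ring_def pdo_ring_def)

locale differential_action = differential_domain d
  for d :: "'a::{idom, ring_char_0} \<Rightarrow> 'a" +
  fixes \<Gamma> :: "('g, 'm) monoid_scheme" and act :: "'g \<Rightarrow> 'a \<Rightarrow> 'a"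
  assumes group: "group \<Gamma>"
    and action: "right_action_by_auts \<Gamma> (ring_of_type_algebra :: 'a ring) act"
begin

lemma act_iso: "\<gamma> \<in> carrier \<Gamma> \<Longrightarrow> act \<gamma> \<in> ring_iso (ring_of_type_algebra :: 'a ring) ring_of_type_algebra"
  using action by (simp add: right_action_by_auts_def)

lemma
  assumes "\<gamma> \<in> carrier \<Gamma>"
  shows act_add: "act \<gamma> (f + h) = act \<gamma> f + act \<gamma> h"
    and act_mult: "act \<gamma> (f * h) = act \<gamma> f * act \<gamma> h"
    and act_1: "act \<gamma> 1 = 1"
    and act_surj: "surj (act \<gamma>)"
  using ring_iso_memE(2-5)[OF act_iso[OF assms]]
  by (simp_all add: ring_of_type_algebra_def bij_is_surj)

lemma act_0: "\<gamma> \<in> carrier \<Gamma> \<Longrightarrow> act \<gamma> 0 = 0"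
  by (rule additive_zero) (rule act_add)

lemma act_one: "act \<one>\<^bsub>\<Gamma>\<^esub> f = f"
  and act_act: "\<gamma> \<in> carrier \<Gamma> \<Longrightarrow> \<gamma>' \<in> carrier \<Gamma> \<Longrightarrow> act \<gamma>' (act \<gamma> f) = act (\<gamma> \<otimes>\<^bsub>\<Gamma>\<^esub> \<gamma>') f"
  using action by (simp_all add: right_action_by_auts_def ring_of_type_algebra_def)

lemma one_closed: "\<one>\<^bsub>\<Gamma>\<^esub> \<in> carrier \<Gamma>"
  and m_closed: "\<gamma> \<in> carrier \<Gamma> \<Longrightarrow> \<gamma>' \<in> carrier \<Gamma> \<Longrightarrow> \<gamma> \<otimes>\<^bsub>\<Gamma>\<^esub> \<gamma>' \<in> carrier \<Gamma>"
  by (rule monoid.one_closed monoid.m_closed group.is_monoid[OF group] | assumption)+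

lemmas inv_closed = group.inv_closed[OF group]
  and l_inv = group.l_inv[OF group]
  and r_inv = group.r_inv[OF group]

lemma compatibility_factor_unique:
  assumes "\<gamma> \<in> carrier \<Gamma>" "\<And>f. u * d (act \<gamma> f) = v * d (act \<gamma> f)"
  shows "u = v"
proof -
  obtain h where h: "d h \<noteq> 0"
    using nonzero by blast
  obtain f where "h = act \<gamma> f"
    using act_surj[OF assms(1)] by (metis surjD)
  with assms(2)[of f] h show ?thesis by simp
qed

text \<open>
  Both sides are the factor that appears when \<open>\<gamma>\<close> and \<open>\<gamma>'\<close> are applied in turn to \<open>d f\<close>.
\<close>

lemma compatibility_factor_cocycle:
  assumes P: "\<And>\<gamma> f. \<gamma> \<in> carrier \<Gamma> \<Longrightarrow> act \<gamma> (d f) = P \<gamma> * d (act \<gamma> f)"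
    and \<gamma>: "\<gamma> \<in> carrier \<Gamma>" "\<gamma>' \<in> carrier \<Gamma>"
  shows "P (\<gamma> \<otimes>\<^bsub>\<Gamma>\<^esub> \<gamma>') = act \<gamma>' (P \<gamma>) * P \<gamma>'"
proof (rule compatibility_factor_unique[OF m_closed[OF \<gamma>]])
  fix f
  have "P (\<gamma> \<otimes>\<^bsub>\<Gamma>\<^esub> \<gamma>') * d (act (\<gamma> \<otimes>\<^bsub>\<Gamma>\<^esub> \<gamma>') f) = act \<gamma>' (act \<gamma> (d f))"
    using P[OF m_closed[OF \<gamma>]] by (simp add: act_act \<gamma>)
  also have "\<dots> = act \<gamma>' (P \<gamma>) * (P \<gamma>' * d (act \<gamma>' (act \<gamma> f)))"
    by (simp add: P \<gamma> act_mult)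
  finally show "P (\<gamma> \<otimes>\<^bsub>\<Gamma>\<^esub> \<gamma>') * d (act (\<gamma> \<otimes>\<^bsub>\<Gamma>\<^esub> \<gamma>') f) =
      act \<gamma>' (P \<gamma>) * P \<gamma>' * d (act (\<gamma> \<otimes>\<^bsub>\<Gamma>\<^esub> \<gamma>') f)"
    by (simp add: act_act \<gamma> mult.assoc)
qed

lemma compatibility_factor_one:
  assumes P: "\<And>\<gamma> f. \<gamma> \<in> carrier \<Gamma> \<Longrightarrow> act \<gamma> (d f) = P \<gamma> * d (act \<gamma> f)"
  shows "P \<one>\<^bsub>\<Gamma>\<^esub> = 1"
  by (rule compatibility_factor_unique[OF one_closed])
    (use P[OF one_closed] in \<open>simp add: act_one\<close>)

text \<open>The cocycle rule for \<open>\<gamma>\<^sup>-\<^sup>1\<close> and \<open>\<gamma>\<close> exhibits the inverse.\<close>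

lemma compatibility_factor_unit:
  assumes P: "\<And>\<gamma> f. \<gamma> \<in> carrier \<Gamma> \<Longrightarrow> act \<gamma> (d f) = P \<gamma> * d (act \<gamma> f)"
    and \<gamma>: "\<gamma> \<in> carrier \<Gamma>"
  shows "P \<gamma> \<in> unit_group"
proof -
  have "1 = act \<gamma> (P (inv\<^bsub>\<Gamma>\<^esub> \<gamma>)) * P \<gamma>"
    using compatibility_factor_cocycle[OF P inv_closed[OF \<gamma>] \<gamma>] compatibility_factor_one[OF P]
    by (simp add: l_inv \<gamma>)
  thus ?thesis
    unfolding unit_group_iff by (metis mult.commute)
qed

text \<open>
  The commutators \<open>[x\<^sup>-\<^sup>1, f] = -d(f)\<close> are constants, and the image of \<open>x\<^sup>-\<^sup>1\<close> inherits this property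
  because \<open>\<gamma>\<close> maps \<open>R\<close> onto itself.
\<close>

lemma extension_on_X_inv:
  assumes S: "S = pdo_ring d \<or> S = do_ring d" and ext: "extends_action \<Gamma> S act \<sigma>"
    and \<gamma>: "\<gamma> \<in> carrier \<Gamma>"
  obtains p q where "\<sigma> \<gamma> fls_X_inv = degree_one p q" "\<And>f. act \<gamma> (d f) = p * d (act \<gamma> f)"
proof -
  let ?Y = "\<sigma> \<gamma> fls_X_inv"
  have iso: "\<sigma> \<gamma> \<in> ring_iso S S" and const: "\<sigma> \<gamma> (fls_const f) = fls_const (act \<gamma> f)" for f
    using ext \<gamma> by (auto simp: extends_action_def right_action_by_auts_def)
  have mult: "\<sigma> \<gamma> (F \<star> G) = \<sigma> \<gamma> F \<star> \<sigma> \<gamma> G" and add: "\<sigma> \<gamma> (F + G) = \<sigma> \<gamma> F + \<sigma> \<gamma> G"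
    if "F \<in> carrier S" "G \<in> carrier S" for F G
    using ring_iso_memE(2,3)[OF iso that] S by (auto simp: pdo_ring_simps do_ring_simps)
  have carrier: "fls_const f \<in> carrier S" "fls_X_inv \<in> carrier S" "fls_X_inv \<star> fls_const f \<in> carrier S" for f
    using S by (auto simp: pdo_ring_simps do_ring_simps nth_X_inv_mult)
  have commutator: "?Y \<star> fls_const (act \<gamma> f) - fls_const (act \<gamma> f) \<star> ?Y = fls_const (- act \<gamma> (d f))" for f
  proof -
    have "fls_const f \<star> fls_X_inv = fls_X_inv \<star> fls_const f + fls_const (d f)"
      by (simp add: pdo_mult_X_inv_const[OF deriv])
    from arg_cong[OF this, of "\<sigma> \<gamma>"]
    have "fls_const (act \<gamma> f) \<star> ?Y = ?Y \<star> fls_const (act \<gamma> f) + fls_const (act \<gamma> (d f))"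
      by (simp only: mult add carrier const)
    thus ?thesis
      by (simp add: fls_eq_iff del: nth_const_mult)
  qed
  have "\<exists>c. ?Y \<star> fls_const h - fls_const h \<star> ?Y = fls_const c" for h
    using commutator act_surj[OF \<gamma>] by (metis surjD)
  from degree_one_if_constant_commutators[OF this]
  obtain p q where pq: "?Y = degree_one p q" by blast
  have "act \<gamma> (d f) = p * d (act \<gamma> f)" for f
    using commutator[of f] unfolding pq degree_one_commutator
    by (metis fls_const_nth neg_equal_iff_equal)
  with pq show ?thesis by (rule that)
qed

lemma d_compatible_if_extends:
  assumes S: "S = pdo_ring d \<or> S = do_ring d" and ext: "extends_action \<Gamma> S act \<sigma>"
  shows "d_compatible \<Gamma> act d"
proof -
  have "\<forall>\<gamma>\<in>carrier \<Gamma>. \<exists>p. \<forall>f. act \<gamma> (d f) = p * d (act \<gamma> f)"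
    using extension_on_X_inv[OF S ext] by metis
  then obtain P where P: "\<And>\<gamma> f. \<gamma> \<in> carrier \<Gamma> \<Longrightarrow> act \<gamma> (d f) = P \<gamma> * d (act \<gamma> f)"
    by metis
  thus ?thesis
    unfolding d_compatible_def using compatibility_factor_unit[OF P] by blast
qed

lemma compatibility_map_cocycle:
  assumes "compatibility_map \<Gamma> act d p"
  shows "p \<in> cocycles1 \<Gamma> act"
  using assms compatibility_factor_cocycle[of p] unfolding compatibility_map_def cocycles1_def by auto

lemma pdo_hom_if_extends:
  assumes "extends_action \<Gamma> (pdo_ring d) act \<sigma>" "\<gamma> \<in> carrier \<Gamma>"
  shows "pdo_hom (\<sigma> \<gamma>)"
proof -
  have "\<sigma> \<gamma> \<in> ring_iso (pdo_ring d) (pdo_ring d)"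
    using assms by (simp add: extends_action_def right_action_by_auts_def)
  from ring_iso_memE(2-4)[OF this] show ?thesis
    by (simp add: pdo_hom_def pdo_ring_simps)
qed

lemma degree_one_image:
  assumes "pdo_hom \<phi>" "\<And>f. \<phi> (fls_const f) = fls_const (g f)" "\<phi> fls_X_inv = degree_one p' q'"
  shows "\<phi> (degree_one p q) = degree_one (g p * p') (g p * q' + g q)"
proof -
  have "\<phi> (degree_one p q) = fls_const (g p) \<star> degree_one p' q' + fls_const (g q)"
    by (simp only: pdo_hom_add[OF assms(1)] pdo_hom_mult[OF assms(1)] assms(2,3))
  also have "\<dots> = degree_one (g p * p') (g p * q' + g q)"
    by (rule fls_eqI) (auto simp: algebra_simps)
  finally show ?thesis .
qed

lemma degree_one_eqD:
  assumes "degree_one p q = degree_one p' q'"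
  shows "p = p'" "q = q'"
  using arg_cong[OF assms, of "\<lambda>F. fls_nth F (-1)"] arg_cong[OF assms, of "\<lambda>F. fls_nth F 0"]
  by simp_all

lemma given_on_x_inv_iff:
  "given_on_x_inv \<Gamma> d p r \<sigma> \<longleftrightarrow>
    (\<forall>\<gamma>\<in>carrier \<Gamma>. \<sigma> \<gamma> fls_X_inv = degree_one (p \<gamma>) (p \<gamma> * r \<gamma>))"
  by (simp add: given_on_x_inv_def pdo_ring_simps)

lemma compatibility_mapD:
  assumes "compatibility_map \<Gamma> act d p" "\<gamma> \<in> carrier \<Gamma>"
  shows "act \<gamma> (d f) = p \<gamma> * d (act \<gamma> f)"
    and "p \<gamma> * inv\<^bsub>ring_of_type_algebra\<^esub> (p \<gamma>) = 1"
  using assms unit_group_inv unfolding compatibility_map_def by auto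

text \<open>
  This is the comparison of the constant terms of \<open>(x\<^sup>-\<^sup>1 \<cdot> \<gamma>) \<cdot> \<gamma>'\<close> and \<open>x\<^sup>-\<^sup>1 \<cdot> \<gamma>\<gamma>'\<close>.
\<close>

lemma twisted_step_iff:
  assumes p: "compatibility_map \<Gamma> act d p" and \<gamma>: "\<gamma> \<in> carrier \<Gamma>" "\<gamma>' \<in> carrier \<Gamma>"
  shows "r (\<gamma> \<otimes>\<^bsub>\<Gamma>\<^esub> \<gamma>') = r \<gamma>' + inv\<^bsub>ring_of_type_algebra\<^esub> (p \<gamma>') * act \<gamma>' (r \<gamma>) \<longleftrightarrow>
    p (\<gamma> \<otimes>\<^bsub>\<Gamma>\<^esub> \<gamma>') * r (\<gamma> \<otimes>\<^bsub>\<Gamma>\<^esub> \<gamma>') = act \<gamma>' (p \<gamma>) * (p \<gamma>' * r \<gamma>') + act \<gamma>' (p \<gamma> * r \<gamma>)"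
proof -
  let ?v = "inv\<^bsub>ring_of_type_algebra\<^esub> (p \<gamma>')" and ?P = "p (\<gamma> \<otimes>\<^bsub>\<Gamma>\<^esub> \<gamma>')"
  have P: "?P = act \<gamma>' (p \<gamma>) * p \<gamma>'"
    by (rule compatibility_factor_cocycle[OF compatibility_mapD(1)[OF p] \<gamma>])
  have v: "p \<gamma>' * ?v = 1"
    by (rule compatibility_mapD(2)[OF p \<gamma>(2)])
  have "?P * (r \<gamma>' + ?v * act \<gamma>' (r \<gamma>)) =
      act \<gamma>' (p \<gamma>) * (p \<gamma>' * r \<gamma>') + act \<gamma>' (p \<gamma>) * ((p \<gamma>' * ?v) * act \<gamma>' (r \<gamma>))"
    unfolding P by (simp only: distrib_left mult.assoc)
  also have "\<dots> = act \<gamma>' (p \<gamma>) * (p \<gamma>' * r \<gamma>') + act \<gamma>' (p \<gamma> * r \<gamma>)"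
    by (simp add: v act_mult[OF \<gamma>(2)])
  finally have eq: "?P * (r \<gamma>' + ?v * act \<gamma>' (r \<gamma>)) =
    act \<gamma>' (p \<gamma>) * (p \<gamma>' * r \<gamma>') + act \<gamma>' (p \<gamma> * r \<gamma>)" .
  have "?P \<noteq> 0"
    using compatibility_mapD(2)[OF p m_closed[OF \<gamma>]] by force
  thus ?thesis
    unfolding eq[symmetric] by simp
qed

lemma twisted_map_if_extends:
  assumes p: "compatibility_map \<Gamma> act d p" and ext: "extends_action \<Gamma> (pdo_ring d) act \<sigma>"
  shows "\<exists>r. twisted_map \<Gamma> act p r \<and> given_on_x_inv \<Gamma> d p r \<sigma>"
proof -
  have const: "\<sigma> \<gamma> (fls_const f) = fls_const (act \<gamma> f)" if "\<gamma> \<in> carrier \<Gamma>" for \<gamma> f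
    using ext that by (simp add: extends_action_def)
  have "\<exists>r. \<sigma> \<gamma> fls_X_inv = degree_one (p \<gamma>) (p \<gamma> * r)" if \<gamma>: "\<gamma> \<in> carrier \<Gamma>" for \<gamma>
  proof -
    obtain p' q where pq: "\<sigma> \<gamma> fls_X_inv = degree_one p' q" "\<And>f. act \<gamma> (d f) = p' * d (act \<gamma> f)"
      using extension_on_X_inv[OF _ ext \<gamma>] by blast
    have "p' = p \<gamma>"
      by (rule compatibility_factor_unique[OF \<gamma>])
        (metis compatibility_mapD(1)[OF p \<gamma>] pq(2))
    moreover have "q = p \<gamma> * (inv\<^bsub>ring_of_type_algebra\<^esub> (p \<gamma>) * q)"
      using compatibility_mapD(2)[OF p \<gamma>] by (simp flip: mult.assoc)
    ultimately show ?thesis using pq(1) by metis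
  qed
  then obtain r where r: "\<sigma> \<gamma> fls_X_inv = degree_one (p \<gamma>) (p \<gamma> * r \<gamma>)" if "\<gamma> \<in> carrier \<Gamma>" for \<gamma>
    by metis
  have "twisted_map \<Gamma> act p r"
    unfolding twisted_map_def
  proof (intro ballI)
    fix \<gamma> \<gamma>' assume \<gamma>: "\<gamma> \<in> carrier \<Gamma>" "\<gamma>' \<in> carrier \<Gamma>"
    have "\<sigma> (\<gamma> \<otimes>\<^bsub>\<Gamma>\<^esub> \<gamma>') fls_X_inv = \<sigma> \<gamma>' (\<sigma> \<gamma> fls_X_inv)"
      using ext \<gamma> by (simp add: extends_action_def right_action_by_auts_def pdo_ring_simps)
    also have "\<dots> = degree_one (act \<gamma>' (p \<gamma>) * p \<gamma>')
        (act \<gamma>' (p \<gamma>) * (p \<gamma>' * r \<gamma>') + act \<gamma>' (p \<gamma> * r \<gamma>))"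
      unfolding r[OF \<gamma>(1)]
      by (rule degree_one_image[OF pdo_hom_if_extends[OF ext \<gamma>(2)] const[OF \<gamma>(2)] r[OF \<gamma>(2)]])
    finally show "r (\<gamma> \<otimes>\<^bsub>\<Gamma>\<^esub> \<gamma>') = r \<gamma>' + inv\<^bsub>ring_of_type_algebra\<^esub> (p \<gamma>') * act \<gamma>' (r \<gamma>)"
      unfolding twisted_step_iff[OF p \<gamma>] r[OF m_closed[OF \<gamma>]] by (rule degree_one_eqD(2))
  qed
  with r show ?thesis
    by (auto simp: given_on_x_inv_iff)
qed

lemma extension_unique:
  assumes half: "c + c = (1::'a)" and p: "compatibility_map \<Gamma> act d p"
    and \<sigma>: "extends_action \<Gamma> (pdo_ring d) act \<sigma>" "given_on_x_inv \<Gamma> d p r \<sigma>"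
    and \<tau>: "extends_action \<Gamma> (pdo_ring d) act \<tau>" "given_on_x_inv \<Gamma> d p r \<tau>"
    and \<gamma>: "\<gamma> \<in> carrier \<Gamma>"
  shows "\<tau> \<gamma> = \<sigma> \<gamma>"
proof -
  have X_inv: "\<sigma> \<gamma> fls_X_inv = degree_one (p \<gamma>) (p \<gamma> * r \<gamma>)"
      "\<tau> \<gamma> fls_X_inv = degree_one (p \<gamma>) (p \<gamma> * r \<gamma>)"
    using \<sigma>(2) \<tau>(2) \<gamma> by (simp_all add: given_on_x_inv_iff)
  have const: "\<tau> \<gamma> (fls_const f) = \<sigma> \<gamma> (fls_const f)" for f
    using \<sigma>(1) \<tau>(1) \<gamma> by (simp add: extends_action_def)
  note hom = pdo_hom_if_extends[OF \<sigma>(1) \<gamma>] pdo_hom_if_extends[OF \<tau>(1) \<gamma>]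
  note unit = compatibility_mapD(2)[OF p \<gamma>]
  show ?thesis
    by (rule continuous_hom_eqI[OF hom(2) pdo_hom_continuous[OF half hom(2) X_inv(2) unit]
          hom(1) pdo_hom_continuous[OF half hom(1) X_inv(1) unit] const])
      (simp only: X_inv)
qed

text \<open>
  The maps obtained for the single group elements form an action because a continuous ring
  homomorphism is determined by its values on the constants and on \<open>x\<^sup>-\<^sup>1\<close>; the condition on \<open>r\<close> is
  the one that makes these values agree. Invertibility comes from the group. Polynomials in
  \<open>x\<^sup>-\<^sup>1\<close> are mapped to polynomials in \<open>x\<^sup>-\<^sup>1\<close>, so the same maps act on the subring.
\<close>

lemma extension_from_twisted_map:
  assumes p: "compatibility_map \<Gamma> act d p" and r: "twisted_map \<Gamma> act p r"
  shows "\<exists>\<sigma>. extends_action \<Gamma> (pdo_ring d) act \<sigma> \<and> extends_action \<Gamma> (do_ring d) act \<sigma> \<and>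
    given_on_x_inv \<Gamma> d p r \<sigma>"
proof -
  have "\<exists>\<phi>. pdo_hom \<phi> \<and> continuous_additive \<phi> \<and> (\<forall>f. \<phi> (fls_const f) = fls_const (act \<gamma> f)) \<and>
      \<phi> fls_X_inv = degree_one (p \<gamma>) (p \<gamma> * r \<gamma>)" if \<gamma>: "\<gamma> \<in> carrier \<Gamma>" for \<gamma>
    by (rule extension_exists[OF act_add[OF \<gamma>] act_mult[OF \<gamma>] act_1[OF \<gamma>] compatibility_mapD[OF p \<gamma>]])
  then obtain \<sigma> where hom: "pdo_hom (\<sigma> \<gamma>)" and cont: "continuous_additive (\<sigma> \<gamma>)"
    and const: "\<sigma> \<gamma> (fls_const f) = fls_const (act \<gamma> f)"
    and X_inv: "\<sigma> \<gamma> fls_X_inv = degree_one (p \<gamma>) (p \<gamma> * r \<gamma>)" if "\<gamma> \<in> carrier \<Gamma>" for \<gamma> f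
    by metis
  have compose: "\<sigma> \<gamma>' (\<sigma> \<gamma> F) = \<sigma> (\<gamma> \<otimes>\<^bsub>\<Gamma>\<^esub> \<gamma>') F" if \<gamma>: "\<gamma> \<in> carrier \<Gamma>" "\<gamma>' \<in> carrier \<Gamma>" for \<gamma> \<gamma>' F
  proof -
    note \<gamma>\<gamma>' = m_closed[OF \<gamma>]
    have "(\<lambda>F. \<sigma> \<gamma>' (\<sigma> \<gamma> F)) = \<sigma> (\<gamma> \<otimes>\<^bsub>\<Gamma>\<^esub> \<gamma>')"
    proof (rule continuous_hom_eqI)
      show "\<sigma> \<gamma>' (\<sigma> \<gamma> (fls_const f)) = \<sigma> (\<gamma> \<otimes>\<^bsub>\<Gamma>\<^esub> \<gamma>') (fls_const f)" for f
        by (simp add: const \<gamma> \<gamma>\<gamma>' act_act)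
      have "\<sigma> \<gamma>' (\<sigma> \<gamma> fls_X_inv) = degree_one (act \<gamma>' (p \<gamma>) * p \<gamma>')
          (act \<gamma>' (p \<gamma>) * (p \<gamma>' * r \<gamma>') + act \<gamma>' (p \<gamma> * r \<gamma>))"
        unfolding X_inv[OF \<gamma>(1)]
        by (rule degree_one_image[OF hom[OF \<gamma>(2)] const[OF \<gamma>(2)] X_inv[OF \<gamma>(2)]])
      also have "act \<gamma>' (p \<gamma>) * p \<gamma>' = p (\<gamma> \<otimes>\<^bsub>\<Gamma>\<^esub> \<gamma>')"
        by (rule compatibility_factor_cocycle[OF compatibility_mapD(1)[OF p] \<gamma>, symmetric])
      also have "act \<gamma>' (p \<gamma>) * (p \<gamma>' * r \<gamma>') + act \<gamma>' (p \<gamma> * r \<gamma>) =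
          p (\<gamma> \<otimes>\<^bsub>\<Gamma>\<^esub> \<gamma>') * r (\<gamma> \<otimes>\<^bsub>\<Gamma>\<^esub> \<gamma>')"
        by (rule twisted_step_iff[OF p \<gamma>, of r, THEN iffD1, symmetric])
          (use r \<gamma> in \<open>simp add: twisted_map_def\<close>)
      finally show "\<sigma> \<gamma>' (\<sigma> \<gamma> fls_X_inv) = \<sigma> (\<gamma> \<otimes>\<^bsub>\<Gamma>\<^esub> \<gamma>') fls_X_inv"
        by (simp only: X_inv[OF \<gamma>\<gamma>'])
    next
      show "pdo_hom (\<lambda>F. \<sigma> \<gamma>' (\<sigma> \<gamma> F))"
        by (rule pdo_hom_compose[OF hom[OF \<gamma>(2)] hom[OF \<gamma>(1)]])
      show "continuous_additive (\<lambda>F. \<sigma> \<gamma>' (\<sigma> \<gamma> F))"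
        by (rule continuous_additive_compose[OF cont[OF \<gamma>(2)] cont[OF \<gamma>(1)]])
    qed (rule hom[OF \<gamma>\<gamma>'] cont[OF \<gamma>\<gamma>'])+
    thus ?thesis by metis
  qed
  have p_one: "p \<one>\<^bsub>\<Gamma>\<^esub> = 1"
    by (rule compatibility_factor_one[OF compatibility_mapD(1)[OF p]])
  have r_one: "r \<one>\<^bsub>\<Gamma>\<^esub> = 0"
  proof -
    have "r (\<one>\<^bsub>\<Gamma>\<^esub> \<otimes>\<^bsub>\<Gamma>\<^esub> \<one>\<^bsub>\<Gamma>\<^esub>) =
        r \<one>\<^bsub>\<Gamma>\<^esub> + inv\<^bsub>ring_of_type_algebra\<^esub> (p \<one>\<^bsub>\<Gamma>\<^esub>) * act \<one>\<^bsub>\<Gamma>\<^esub> (r \<one>\<^bsub>\<Gamma>\<^esub>)"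
      using r one_closed unfolding twisted_map_def by blast
    moreover have "inv\<^bsub>ring_of_type_algebra\<^esub> (p \<one>\<^bsub>\<Gamma>\<^esub>) = 1"
      using compatibility_mapD(2)[OF p one_closed] p_one by simp
    moreover have "\<one>\<^bsub>\<Gamma>\<^esub> \<otimes>\<^bsub>\<Gamma>\<^esub> \<one>\<^bsub>\<Gamma>\<^esub> = \<one>\<^bsub>\<Gamma>\<^esub>"
      by (rule monoid.l_one[OF group.is_monoid[OF group] one_closed])
    ultimately show ?thesis
      by (simp add: act_one)
  qed
  have ident: "\<sigma> \<one>\<^bsub>\<Gamma>\<^esub> F = F" for F
  proof -
    have "\<sigma> \<one>\<^bsub>\<Gamma>\<^esub> = (\<lambda>F. F)"
    proof (rule continuous_hom_eqI)
      show "pdo_hom (\<lambda>F. F)" by (simp add: pdo_hom_def)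
      show "continuous_additive (\<lambda>F::'a fls. F)" by (rule continuous_additiveI[where c = 0]) auto
    qed (simp_all add: hom cont const X_inv one_closed act_one p_one r_one)
    thus ?thesis by metis
  qed
  have left_inverse: "\<sigma> (inv\<^bsub>\<Gamma>\<^esub> \<gamma>) (\<sigma> \<gamma> F) = F" and right_inverse: "\<sigma> \<gamma> (\<sigma> (inv\<^bsub>\<Gamma>\<^esub> \<gamma>) F) = F"
    if "\<gamma> \<in> carrier \<Gamma>" for \<gamma> F
    using that by (simp_all add: compose inv_closed l_inv r_inv ident)
  have iso: "\<sigma> \<gamma> \<in> ring_iso S S"
    if S: "S = pdo_ring d \<or> S = do_ring d" and \<gamma>: "\<gamma> \<in> carrier \<Gamma>" for S \<gamma>
  proof -
    have maps: "\<sigma> \<gamma> F \<in> carrier S" if "\<gamma> \<in> carrier \<Gamma>" "F \<in> carrier S" for \<gamma> F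
      using S
    proof
      assume "S = do_ring d"
      with that show ?thesis
        using pdo_hom_preserves_polynomials[OF hom[OF that(1)] const[OF that(1)] X_inv[OF that(1)]]
        by (simp add: do_ring_simps)
    qed (simp add: pdo_ring_simps)
    show ?thesis
    proof (rule ring_iso_memI)
      show "bij_betw (\<sigma> \<gamma>) (carrier S) (carrier S)"
        by (rule bij_betw_byWitness[where f' = "\<sigma> (inv\<^bsub>\<Gamma>\<^esub> \<gamma>)"])
          (use maps \<gamma> inv_closed in \<open>auto simp: left_inverse right_inverse\<close>)
    qed (use S maps[OF \<gamma>] pdo_hom_add[OF hom[OF \<gamma>]] pdo_hom_mult[OF hom[OF \<gamma>]] pdo_hom_1[OF hom[OF \<gamma>]]
        in \<open>auto simp: pdo_ring_simps do_ring_simps\<close>)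
  qed
  have "extends_action \<Gamma> S act \<sigma>" if "S = pdo_ring d \<or> S = do_ring d" for S
    using iso[OF that] ident compose const
    unfolding extends_action_def right_action_by_auts_def by blast
  moreover have "given_on_x_inv \<Gamma> d p r \<sigma>"
    using X_inv by (simp add: given_on_x_inv_iff)
  ultimately show ?thesis by blast
qed

lemma extends_if_d_compatible:
  assumes "d_compatible \<Gamma> act d"
  shows "\<exists>\<sigma>. extends_action \<Gamma> (pdo_ring d) act \<sigma> \<and> extends_action \<Gamma> (do_ring d) act \<sigma>"
proof -
  have "\<exists>p. compatibility_map \<Gamma> act d p"
    using assms unfolding d_compatible_def compatibility_map_def by metis
  then obtain p where p: "compatibility_map \<Gamma> act d p" by blast
  \<comment> \<open>With \<open>r = 0\<close> the rule for \<open>r\<close> holds trivially.\<close>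
  have "twisted_map \<Gamma> act p (\<lambda>_. 0)"
    by (simp add: twisted_map_def act_0)
  from extension_from_twisted_map[OF p this] show ?thesis by blast
qed

end

section \<open>The extension theorem\<close>

lemma half_exists:
  assumes "\<exists>\<iota>. \<iota> \<in> ring_hom (ring_of_type_algebra :: rat ring) (ring_of_type_algebra :: 'a ring) \<and> inj \<iota>"
  shows "\<exists>c. c + c = (1::'a::comm_ring_1)"
proof -
  obtain \<iota> where hom: "\<iota> \<in> ring_hom (ring_of_type_algebra :: rat ring) (ring_of_type_algebra :: 'a ring)"
    using assms by blast
  have "\<iota> (1/2) + \<iota> (1/2) = \<iota> (1/2 + 1/2)"
    using ring_hom_add[OF hom, of "1/2" "1/2"] by (simp add: ring_of_type_algebra_def)
  also have "\<dots> = 1"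
    using ring_hom_one[OF hom] by (simp add: ring_of_type_algebra_def)
  finally show ?thesis by blast
qed

theorem theorem1p2p5:
  fixes d :: "'a::{idom, ring_char_0} \<Rightarrow> 'a"
    and \<Gamma> :: "('g, 'm) monoid_scheme"
    and act :: "'g \<Rightarrow> 'a \<Rightarrow> 'a"
  assumes contains_rat:
      "\<exists>\<iota>. \<iota> \<in> ring_hom (ring_of_type_algebra :: rat ring) (ring_of_type_algebra :: 'a ring) \<and> inj \<iota>"
    and deriv: "derivation d"
    and nonzero: "\<exists>f. d f \<noteq> 0"
    and grp: "group \<Gamma>"
    and action: "right_action_by_auts \<Gamma> (ring_of_type_algebra :: 'a ring) act"
  shows
    "((\<exists>\<sigma>. extends_action \<Gamma> (pdo_ring d) act \<sigma>) \<longleftrightarrow> d_compatible \<Gamma> act d) \<and>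
     (\<forall>p. compatibility_map \<Gamma> act d p \<longrightarrow>
        p \<in> cocycles1 \<Gamma> act \<and>
        (\<forall>\<sigma>. extends_action \<Gamma> (pdo_ring d) act \<sigma> \<longrightarrow>
           (\<exists>r. twisted_map \<Gamma> act p r \<and> given_on_x_inv \<Gamma> d p r \<sigma>)) \<and>
        (\<forall>r. twisted_map \<Gamma> act p r \<longrightarrow>
           (\<exists>\<sigma>. extends_action \<Gamma> (pdo_ring d) act \<sigma> \<and> given_on_x_inv \<Gamma> d p r \<sigma> \<and>
             (\<forall>\<tau>. extends_action \<Gamma> (pdo_ring d) act \<tau> \<and> given_on_x_inv \<Gamma> d p r \<tau> \<longrightarrow>
               (\<forall>\<gamma>\<in>carrier \<Gamma>. \<tau> \<gamma> = \<sigma> \<gamma>))))) \<and>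
     ((\<exists>\<sigma>. extends_action \<Gamma> (pdo_ring d) act \<sigma>) \<longleftrightarrow>
      (\<exists>\<sigma>. extends_action \<Gamma> (do_ring d) act \<sigma>))"
proof -
  interpret differential_action d \<Gamma> act
    by (intro differential_action.intro differential_domain.intro differential_ring.intro
        differential_domain_axioms.intro differential_action_axioms.intro deriv nonzero grp action)
  obtain c :: 'a where half: "c + c = 1"
    using half_exists[OF contains_rat] by blast
  let ?B = "\<exists>\<sigma>. extends_action \<Gamma> (pdo_ring d) act \<sigma>"
  let ?A = "\<exists>\<sigma>. extends_action \<Gamma> (do_ring d) act \<sigma>"
  have B: "?B \<longleftrightarrow> d_compatible \<Gamma> act d"
    using d_compatible_if_extends[of "pdo_ring d"] extends_if_d_compatible by blast
  have A: "?A \<longleftrightarrow> d_compatible \<Gamma> act d"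
    using d_compatible_if_extends[of "do_ring d"] extends_if_d_compatible by blast
  show ?thesis
  proof (intro conjI allI impI)
    show "?B \<longleftrightarrow> d_compatible \<Gamma> act d" by (rule B)
    show "?B \<longleftrightarrow> ?A" by (simp only: A B)
  next
    fix p assume p: "compatibility_map \<Gamma> act d p"
    show "p \<in> cocycles1 \<Gamma> act"
      by (rule compatibility_map_cocycle[OF p])
    show "\<exists>r. twisted_map \<Gamma> act p r \<and> given_on_x_inv \<Gamma> d p r \<sigma>"
      if "extends_action \<Gamma> (pdo_ring d) act \<sigma>" for \<sigma>
      by (rule twisted_map_if_extends[OF p that])
    fix r assume r: "twisted_map \<Gamma> act p r"
    obtain \<sigma> where \<sigma>: "extends_action \<Gamma> (pdo_ring d) act \<sigma>" "given_on_x_inv \<Gamma> d p r \<sigma>"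
      using extension_from_twisted_map[OF p r] by blast
    show "\<exists>\<sigma>. extends_action \<Gamma> (pdo_ring d) act \<sigma> \<and> given_on_x_inv \<Gamma> d p r \<sigma> \<and>
        (\<forall>\<tau>. extends_action \<Gamma> (pdo_ring d) act \<tau> \<and> given_on_x_inv \<Gamma> d p r \<tau> \<longrightarrow>
          (\<forall>\<gamma>\<in>carrier \<Gamma>. \<tau> \<gamma> = \<sigma> \<gamma>))"
      using \<sigma> extension_unique[OF half p \<sigma>] by blast
  qed
qed

end
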